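(* Let $K$ be a number field, $\overline{K}$ an algebraic closure of $K$, $K_{ab}\subseteq\overline{K}$ the maximal abelian extension of $K$, and $E/K$ an elliptic curve over $K$. Then for any complex conjugation automorphism $\sigma\in Gal(\overline{K}/K)$, the group $E((K_{ab})^{\sigma})$ has infinite rank. Hence $E(\overline{K}^{\sigma})$ has infinite rank.
   Context: A complex conjugation automorphism is an element $\sigma\in Gal(\overline{K}/K)$ of order $2$. For a subfield $M\subseteq\overline{K}$ with $\sigma(M)=M$, $M^{\sigma}$ denotes the subfield of $M$ fixed by $\sigma$. *)

theory Defs
  imports
    "HOL-Algebra.Algebra"
    "HOL-Algebra.Algebraic_Closure_Type"
    "HOL-Computational_Algebra.Computational_Algebra"
    "HOL-Library.Extended_Nat"
begin

text \<open>
  The ambient algebraic closure is a type \<open>'a\<close> of an algebraically closed field, regarded as a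
  record structure where notions from the algebra library are needed.  All other fields are
  subsets of it.
\<close>

abbreviation is_subfield :: "'a::field set \<Rightarrow> bool" where
  "is_subfield K \<equiv> subfield K ring_of_type_algebra"

lemma is_subfield_iff:
  fixes K :: "'a::field set"
  shows "is_subfield K \<longleftrightarrow>
    0 \<in> K \<and> 1 \<in> K \<and> (\<forall>x\<in>K. \<forall>y\<in>K. x + y \<in> K \<and> x * y \<in> K) \<and>
    (\<forall>x\<in>K. - x \<in> K \<and> inverse x \<in> K)"
proof -
  define R where "R = (ring_of_type_algebra :: 'a ring)"
  interpret R: field R
    unfolding R_def by (rule field_from_type_algebra)
  have ops: "carrier R = UNIV" "monoid.mult R = (*)" "monoid.one R = 1"
      "ring.zero R = 0" "ring.add R = (+)"
    by (simp_all add: R_def ring_of_type_algebra_def)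
  have neg: "a_inv R x = - x" for x
    using R.add.inv_equality[of "- x" x] by (simp add: ops)
  have recip: "m_inv R x = inverse x" if "x \<noteq> 0" for x
    using that R.inv_unique'[of x "inverse x"] by (simp add: ops)
  show ?thesis
    unfolding R_def[symmetric]
  proof
    assume "subfield K R"
    then interpret S: subfield K R .
    have "inverse x \<in> K" if "x \<in> K" for x
    proof (cases "x = 0")
      case True
      then show ?thesis using that by simp
    next
      case False
      then show ?thesis
        using R.subfield_m_inv(1)[OF \<open>subfield K R\<close>, of x] that
        by (simp add: recip ops)
    qed
    then show "0 \<in> K \<and> 1 \<in> K \<and> (\<forall>x\<in>K. \<forall>y\<in>K. x + y \<in> K \<and> x * y \<in> K) \<and>
        (\<forall>x\<in>K. - x \<in> K \<and> inverse x \<in> K)"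
      using S.subring_axioms R.subring_props[OF \<open>subfield K R\<close>]
      by (auto simp: ops neg)
  next
    assume K: "0 \<in> K \<and> 1 \<in> K \<and> (\<forall>x\<in>K. \<forall>y\<in>K. x + y \<in> K \<and> x * y \<in> K) \<and>
        (\<forall>x\<in>K. - x \<in> K \<and> inverse x \<in> K)"
    have "subring K R"
      by (rule R.subringI) (use K in \<open>auto simp: ops neg\<close>)
    then show "subfield K R"
      by (rule R.subfieldI') (use K in \<open>auto simp: ops recip\<close>)
  qed
qed

lemma vector_space_of_rat: "vector_space (\<lambda>(q::rat) (x::'a::field_char_0). of_rat q * x)"
  by unfold_locales (simp_all add: algebra_simps of_rat_add of_rat_mult)

definition number_field :: "'a::field_char_0 set \<Rightarrow> bool" where
  "number_field K \<longleftrightarrow> is_subfield K \<and>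
     (\<exists>B. finite B \<and> K = module.span (\<lambda>(q::rat) x. of_rat q * x) B)"

definition algebraic_over :: "'a::field set \<Rightarrow> 'a \<Rightarrow> bool" where
  "algebraic_over K x \<longleftrightarrow> (\<exists>p. p \<noteq> 0 \<and> (\<forall>i. coeff p i \<in> K) \<and> poly p x = 0)"

text \<open>
  Automorphisms of \<open>M\<close> are functions on the whole ambient type; as in \<^const>\<open>Bij\<close> they are made
  unique by being \<^const>\<open>undefined\<close> outside \<open>M\<close>.
\<close>

definition Gal :: "'a::field set \<Rightarrow> 'a set \<Rightarrow> ('a \<Rightarrow> 'a) monoid" where
  "Gal M K = (BijGroup M)\<lparr>carrier :=
     {f \<in> Bij M. (\<forall>x\<in>M. \<forall>y\<in>M. f (x + y) = f x + f y \<and> f (x * y) = f x * f y) \<and>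
                 (\<forall>x\<in>K. f x = x)}\<rparr>"

lemma group_Gal:
  fixes M K :: "'a::field set"
  assumes M: "is_subfield M" and KM: "K \<subseteq> M"
  shows "group (Gal M K)"
proof -
  let ?G = "BijGroup M"
  let ?H = "{f \<in> Bij M. (\<forall>x\<in>M. \<forall>y\<in>M. f (x + y) = f x + f y \<and> f (x * y) = f x * f y) \<and>
                 (\<forall>x\<in>K. f x = x)}"
  interpret G: group ?G by (rule group_BijGroup)
  have cl: "x + y \<in> M" "x * y \<in> M" if "x \<in> M" "y \<in> M" for x y
    using M that by (auto simp: is_subfield_iff)
  have "subgroup ?H ?G"
  proof (rule G.subgroupI)
    show "?H \<subseteq> carrier ?G" by (auto simp: BijGroup_def)
    have "(\<lambda>x\<in>M. x) \<in> ?H" using cl KM by (auto simp: id_Bij)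
    then show "?H \<noteq> {}" by blast
  next
    fix f assume f: "f \<in> ?H"
    then have fB: "f \<in> Bij M" by simp
    have fs: "(+) \<in> M \<rightarrow> M \<rightarrow> M" "(*) \<in> M \<rightarrow> M \<rightarrow> M" using cl by auto
    have "inv_into M f (x + y) = inv_into M f x + inv_into M f y"
      if "x \<in> M" "y \<in> M" for x y
      by (rule Bij_inv_into_lemma[OF _ fB fs(1) that]) (use f in auto)
    moreover have "inv_into M f (x * y) = inv_into M f x * inv_into M f y"
      if "x \<in> M" "y \<in> M" for x y
      by (rule Bij_inv_into_lemma[OF _ fB fs(2) that]) (use f in auto)
    moreover have "inv_into M f x = x" if "x \<in> K" for x
    proof -
      have "inj_on f M" "f x = x" "x \<in> M"
        using f that KM by (auto simp: Bij_def bij_betw_def)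
      then show ?thesis using inv_into_f_f[of f M x] by simp
    qed
    ultimately show "inv\<^bsub>?G\<^esub> f \<in> ?H"
      using cl KM restrict_inv_into_Bij[OF fB] by (auto simp: inv_BijGroup[OF fB])
  next
    fix f g assume "f \<in> ?H" "g \<in> ?H"
    then show "f \<otimes>\<^bsub>?G\<^esub> g \<in> ?H"
      using cl KM Bij_imp_funcset[of g M]
      by (auto simp: BijGroup_def compose_Bij compose_eq Pi_iff subset_iff)
  qed
  then show ?thesis
    unfolding Gal_def by (rule G.subgroup_imp_group)
qed

definition fixed_field :: "'a set \<Rightarrow> ('a \<Rightarrow> 'a) \<Rightarrow> 'a set" where
  "fixed_field M \<sigma> = {x \<in> M. \<sigma> x = x}"

definition galois_extension :: "'a::field set \<Rightarrow> 'a set \<Rightarrow> bool" where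
  "galois_extension K M \<longleftrightarrow>
     is_subfield K \<and> is_subfield M \<and> K \<subseteq> M \<and> (\<forall>x\<in>M. algebraic_over K x) \<and>
     {x \<in> M. \<forall>f \<in> carrier (Gal M K). f x = x} = K"

definition abelian_extension :: "'a::field set \<Rightarrow> 'a set \<Rightarrow> bool" where
  "abelian_extension K M \<longleftrightarrow> galois_extension K M \<and> comm_group (Gal M K)"

text \<open>The compositum of all abelian extensions of \<open>K\<close> inside the ambient field.\<close>

definition max_abelian_extension :: "'a::field set \<Rightarrow> 'a set" where
  "max_abelian_extension K =
     \<Inter> {L. is_subfield L \<and> (\<forall>M. abelian_extension K M \<longrightarrow> M \<subseteq> L)}"

definition complex_conjugation :: "'a::field set \<Rightarrow> ('a \<Rightarrow> 'a) \<Rightarrow> bool" where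
  "complex_conjugation K \<sigma> \<longleftrightarrow>
     \<sigma> \<in> carrier (Gal UNIV K) \<and> group.ord (Gal UNIV K) \<sigma> = 2"

text \<open>
  Elliptic curves are given by general Weierstrass equations
  $y^2 + a_1 x y + a_3 y = x^3 + a_2 x^2 + a_4 x + a_6$ of nonzero discriminant.
\<close>

record 'a weierstrass =
  wa1 :: 'a
  wa2 :: 'a
  wa3 :: 'a
  wa4 :: 'a
  wa6 :: 'a

definition discriminant :: "'a::field weierstrass \<Rightarrow> 'a" where
  "discriminant E =
    (let b2 = (wa1 E)\<^sup>2 + 4 * wa2 E;
         b4 = 2 * wa4 E + wa1 E * wa3 E;
         b6 = (wa3 E)\<^sup>2 + 4 * wa6 E;
         b8 = (wa1 E)\<^sup>2 * wa6 E + 4 * wa2 E * wa6 E - wa1 E * wa3 E * wa4 E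
              + wa2 E * (wa3 E)\<^sup>2 - (wa4 E)\<^sup>2
     in - b2\<^sup>2 * b8 - 8 * b4 ^ 3 - 27 * b6\<^sup>2 + 9 * b2 * b4 * b6)"

definition elliptic_curve_over :: "'a::field set \<Rightarrow> 'a weierstrass \<Rightarrow> bool" where
  "elliptic_curve_over K E \<longleftrightarrow>
     {wa1 E, wa2 E, wa3 E, wa4 E, wa6 E} \<subseteq> K \<and> discriminant E \<noteq> 0"

datatype 'a ec_point = Infinity | Affine 'a 'a

definition ec_points :: "'a::field weierstrass \<Rightarrow> 'a set \<Rightarrow> 'a ec_point set" where
  "ec_points E L = insert Infinity
     {Affine x y | x y. x \<in> L \<and> y \<in> L \<and>
        y\<^sup>2 + wa1 E * x * y + wa3 E * y = x ^ 3 + wa2 E * x\<^sup>2 + wa4 E * x + wa6 E}"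

text \<open>
  Chord-tangent addition: \<open>y = l * x + v\<close> is the line through the two points (the tangent line
  if they coincide), and the sum is the negative of the third intersection point, where
  \<open>- (x, y) = (x, - y - a\<^sub>1 x - a\<^sub>3)\<close>.
\<close>

fun ec_add :: "'a::field weierstrass \<Rightarrow> 'a ec_point \<Rightarrow> 'a ec_point \<Rightarrow> 'a ec_point" where
  "ec_add E Infinity Q = Q"
| "ec_add E P Infinity = P"
| "ec_add E (Affine x1 y1) (Affine x2 y2) =
    (if x1 = x2 \<and> y1 + y2 + wa1 E * x2 + wa3 E = 0 then Infinity
     else let l = (if x1 = x2
                   then (3 * x1\<^sup>2 + 2 * wa2 E * x1 + wa4 E - wa1 E * y1)
                          / (2 * y1 + wa1 E * x1 + wa3 E)
                   else (y2 - y1) / (x2 - x1));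
              v = y1 - l * x1;
              x3 = l\<^sup>2 + wa1 E * l - wa2 E - x1 - x2
          in Affine x3 (- (l + wa1 E) * x3 - v - wa3 E))"

definition mordell_weil_group :: "'a::field weierstrass \<Rightarrow> 'a set \<Rightarrow> 'a ec_point monoid" where
  "mordell_weil_group E L =
     \<lparr>carrier = ec_points E L, monoid.mult = ec_add E, one = Infinity\<rparr>"

text \<open>
  The rank of a (multiplicatively written) abelian group is the supremum of the sizes of its
  finite subsets that are linearly independent over the integers.
\<close>

definition int_independent :: "('a, 'b) monoid_scheme \<Rightarrow> 'a set \<Rightarrow> bool" where
  "int_independent G S \<longleftrightarrow> finite S \<and> S \<subseteq> carrier G \<and>
     (\<forall>n :: 'a \<Rightarrow> int. finprod G (\<lambda>x. x [^]\<^bsub>G\<^esub> n x) S = \<one>\<^bsub>G\<^esub> \<longrightarrow> (\<forall>x\<in>S. n x = 0))"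

definition abelian_group_rank :: "('a, 'b) monoid_scheme \<Rightarrow> enat" where
  "abelian_group_rank G = (SUP S \<in> {S. int_independent G S}. enat (card S))"

end

theory Submission
  imports Defs "Jordan_Normal_Form.Char_Poly"
begin

hide_const (open) Divisibility.prime

unbundle no fps_syntax

text \<open>
  After completing the square the curve is \<open>y\<^sup>2 = f x\<close> with \<open>f\<close> a monic cubic over \<open>K\<close>.  For every number
  field \<open>F \<supseteq> K\<close> fixed by \<open>\<sigma>\<close> we produce a point \<open>P = (x, y)\<close> with \<open>x \<in> K\<close> and \<open>y\<close> fixed by \<open>\<sigma>\<close>
  such that no nonzero multiple of \<open>P\<close> is defined over \<open>F\<close>.  As \<open>y\<^sup>2 = f x\<close> lies in \<open>K\<close>, the point is defined
  over the fixed field of \<open>\<sigma>\<close> in the maximal abelian extension; replacing \<open>F\<close> by \<open>F(y)\<close> and repeating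
  gives infinitely many independent points.

  Take \<open>x = D + 1 / (t q)\<close> with \<open>D\<close> large, \<open>t\<close> highly divisible and \<open>q\<close> a large prime.  The fixed field of
  \<open>\<sigma>\<close> is real closed and \<open>f x\<close> is positive there, so \<open>f x = y\<^sup>2\<close> with \<open>y\<close> fixed by \<open>\<sigma>\<close>.  At an unramified
  prime \<open>q\<close> of \<open>F\<close> the value \<open>f x\<close> has the odd valuation \<open>-3\<close>, so \<open>y \<notin> F\<close>.  The conjugation of \<open>F(y)\<close> over
  \<open>F\<close> maps \<open>P\<close> to \<open>-P\<close>, hence a multiple of \<open>P\<close> over \<open>F\<close> equals its own negative.  But \<open>P\<close> has infinite
  order: \<open>x\<close> is \<open>2\<close>-adically large by the choice of \<open>t\<close>, and then each doubling multiplies it by \<open>1/4\<close> times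
  a \<open>2\<close>-adic unit.
\<close>

lemma subfield_closed:
  assumes "is_subfield (L :: 'a::field_char_0 set)"
  shows "0 \<in> L" "1 \<in> L" "numeral k \<in> L" "of_nat n \<in> L"
    "x \<in> L \<Longrightarrow> y \<in> L \<Longrightarrow> x + y \<in> L" "x \<in> L \<Longrightarrow> y \<in> L \<Longrightarrow> x - y \<in> L"
    "x \<in> L \<Longrightarrow> y \<in> L \<Longrightarrow> x * y \<in> L" "x \<in> L \<Longrightarrow> y \<in> L \<Longrightarrow> x / y \<in> L"
    "x \<in> L \<Longrightarrow> - x \<in> L" "x \<in> L \<Longrightarrow> inverse x \<in> L" "x \<in> L \<Longrightarrow> x ^ n \<in> L"
proof -
  note L = assms[unfolded is_subfield_iff]
  show nat: "of_nat n \<in> L" for n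
    by (induction n) (use L in auto)
  show "numeral k \<in> L"
    using nat[of "numeral k"] by simp
  show "x \<in> L \<Longrightarrow> x ^ n \<in> L"
    by (induction n) (use L in auto)
  show "x \<in> L \<Longrightarrow> y \<in> L \<Longrightarrow> x - y \<in> L"
    using L by (metis add_uminus_conv_diff)
  show "x \<in> L \<Longrightarrow> y \<in> L \<Longrightarrow> x / y \<in> L"
    using L by (metis divide_inverse)
qed (use assms[unfolded is_subfield_iff] in auto)

section \<open>The group law on a nonsingular cubic\<close>

definition ec_slope :: "'a::field weierstrass \<Rightarrow> 'a \<Rightarrow> 'a \<Rightarrow> 'a \<Rightarrow> 'a \<Rightarrow> 'a" where
  "ec_slope E x1 y1 x2 y2 =
    (if x1 = x2 then (3 * x1\<^sup>2 + 2 * wa2 E * x1 + wa4 E - wa1 E * y1) / (2 * y1 + wa1 E * x1 + wa3 E)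
     else (y2 - y1) / (x2 - x1))"

lemma ec_add_Affine:
  assumes "\<not> (x1 = x2 \<and> y1 + y2 + wa1 E * x2 + wa3 E = 0)"
    and l: "l = ec_slope E x1 y1 x2 y2" and x3: "x3 = l\<^sup>2 + wa1 E * l - wa2 E - x1 - x2"
  shows "ec_add E (Affine x1 y1) (Affine x2 y2) = Affine x3 (- (l + wa1 E) * x3 - (y1 - l * x1) - wa3 E)"
  unfolding ec_add.simps if_not_P[OF assms(1)] ec_slope_def[symmetric] x3 l Let_def ..

definition cubic :: "'a::field \<Rightarrow> 'a \<Rightarrow> 'a \<Rightarrow> 'a \<Rightarrow> 'a" where
  "cubic a b c x = x ^ 3 + a * x\<^sup>2 + b * x + c"

definition cubic_curve :: "'a::field \<Rightarrow> 'a \<Rightarrow> 'a \<Rightarrow> 'a weierstrass" where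
  "cubic_curve a b c = \<lparr>wa1 = 0, wa2 = a, wa3 = 0, wa4 = b, wa6 = c\<rparr>"

lemma cubic_curve_simps [simp]:
  "wa1 (cubic_curve a b c) = 0" "wa2 (cubic_curve a b c) = a" "wa3 (cubic_curve a b c) = 0"
  "wa4 (cubic_curve a b c) = b" "wa6 (cubic_curve a b c) = c"
  by (simp_all add: cubic_curve_def)

fun neg_point :: "'a::field ec_point \<Rightarrow> 'a ec_point" where
  "neg_point Infinity = Infinity"
| "neg_point (Affine x y) = Affine x (- y)"

lemma neg_point_neg_point [simp]: "neg_point (neg_point P) = P"
  by (cases P) auto

lemma ec_add_Infinity_right [simp]: "ec_add E P Infinity = P"
  by (cases P) auto

locale nonsingular_cubic =
  fixes a b c :: "'a::{field_char_0, alg_closed_field}"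
  assumes nonsingular: "cubic a b c x = 0 \<Longrightarrow> 3 * x\<^sup>2 + 2 * a * x + b \<noteq> 0"
begin

abbreviation f :: "'a \<Rightarrow> 'a" where "f \<equiv> cubic a b c"

abbreviation add_point :: "'a ec_point \<Rightarrow> 'a ec_point \<Rightarrow> 'a ec_point" (infixl "\<boxplus>" 65) where
  "add_point \<equiv> ec_add (cubic_curve a b c)"

abbreviation points :: "'a set \<Rightarrow> 'a ec_point set" where
  "points \<equiv> ec_points (cubic_curve a b c)"

abbreviation point_group :: "'a set \<Rightarrow> 'a ec_point monoid" where
  "point_group \<equiv> mordell_weil_group (cubic_curve a b c)"

abbreviation C :: "'a ec_point set" where "C \<equiv> points UNIV"

lemma Infinity_in_C [simp]: "Infinity \<in> C"
  by (simp add: ec_points_def)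

lemma Affine_in_C [simp]: "Affine x y \<in> C \<longleftrightarrow> y\<^sup>2 = f x"
  by (auto simp: ec_points_def cubic_def)

lemma neg_point_in_C [simp]: "neg_point P \<in> C \<longleftrightarrow> P \<in> C"
  by (cases P) auto

lemma add_neg_point [simp]: "P \<boxplus> neg_point P = Infinity" "neg_point P \<boxplus> P = Infinity"
  by (cases P; simp)+

definition line_meets :: "'a \<Rightarrow> 'a \<Rightarrow> 'a \<Rightarrow> 'a \<Rightarrow> 'a \<Rightarrow> bool" where
  "line_meets l v x1 x2 x3 \<longleftrightarrow>
     [:c, b, a, 1:] - [:v, l:]\<^sup>2 = [:- x1, 1:] * [:- x2, 1:] * [:- x3, 1:]"

lemma line_meets_iff:
  "line_meets l v x1 x2 x3 \<longleftrightarrow> x3 = l\<^sup>2 - a - x1 - x2 \<and>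
     x1 * x2 + x1 * x3 + x2 * x3 = b - 2 * l * v \<and> x1 * x2 * x3 = v\<^sup>2 - c"
proof -
  have "line_meets l v x1 x2 x3 \<longleftrightarrow> c - v\<^sup>2 = - (x1 * x2 * x3) \<and>
     b - 2 * l * v = x1 * x2 + x1 * x3 + x2 * x3 \<and> a - l\<^sup>2 = - (x1 + x2 + x3)"
    by (simp add: line_meets_def power2_eq_square algebra_simps)
  also have "c - v\<^sup>2 = - (x1 * x2 * x3) \<longleftrightarrow> x1 * x2 * x3 = v\<^sup>2 - c"
    by (metis minus_diff_eq neg_equal_iff_equal)
  also have "a - l\<^sup>2 = - (x1 + x2 + x3) \<longleftrightarrow> x3 = l\<^sup>2 - a - x1 - x2"
    by (auto simp: algebra_simps)
  finally show ?thesis by auto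
qed

lemma line_meetsD:
  assumes "line_meets l v x1 x2 x3"
  shows "x3 = l\<^sup>2 - a - x1 - x2" "x1 * x2 + x1 * x3 + x2 * x3 = b - 2 * l * v"
    "x1 * x2 * x3 = v\<^sup>2 - c"
  using assms unfolding line_meets_iff by blast+

lemma line_meets_tangent:
  assumes "line_meets l v x x x3"
  shows "3 * x\<^sup>2 + 2 * a * x + b = 2 * (l * x + v) * l"
  using line_meetsD[OF assms] by Groebner_Basis.algebra

lemma line_meets_commute: "line_meets l v x1 x2 x3 \<Longrightarrow> line_meets l v x2 x1 x3"
  by (simp add: line_meets_def mult.commute)

lemma line_meets_reflect: "line_meets l v x1 x2 x3 \<Longrightarrow> line_meets (- l) (- v) x3 x2 x1"
  by (simp add: line_meets_iff algebra_simps)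

lemma add_collinear:
  assumes "line_meets l v x1 x2 x3"
  shows "Affine x1 (l * x1 + v) \<boxplus> Affine x2 (l * x2 + v) = Affine x3 (- (l * x3 + v))"
proof -
  note vieta = line_meetsD[OF assms]
  have x3: "l\<^sup>2 - a - x1 - x2 = x3"
    using vieta(1) by simp
  show ?thesis
  proof (cases "x1 = x2")
    case False
    then have "l = ec_slope (cubic_curve a b c) x1 (l * x1 + v) x2 (l * x2 + v)"
      by (simp add: ec_slope_def field_simps)
    then have "Affine x1 (l * x1 + v) \<boxplus> Affine x2 (l * x2 + v) = Affine x3 (- l * x3 - (l * x1 + v - l * x1))"
      using ec_add_Affine[of x1 x2 _ _ "cubic_curve a b c" l x3] False x3 by (simp del: ec_add.simps)
    then show ?thesis
      by (simp del: ec_add.simps)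
  next
    case True
    define y where "y = l * x1 + v"
    have tangent: "3 * x1\<^sup>2 + 2 * a * x1 + b = 2 * y * l"
      using line_meets_tangent assms unfolding True y_def by blast
    have "y\<^sup>2 = f x1"
      using vieta unfolding y_def cubic_def by Groebner_Basis.algebra
    then have "y \<noteq> 0"
      using nonsingular[of x1] tangent by auto
    then have "l = ec_slope (cubic_curve a b c) x1 y x1 y" "y + y \<noteq> 0"
      by (simp_all add: ec_slope_def tangent flip: mult_2)
    then have "Affine x1 y \<boxplus> Affine x1 y = Affine x3 (- l * x3 - (y - l * x1))"
      using ec_add_Affine[of x1 x1 y y "cubic_curve a b c" l x3] x3 True by (simp del: ec_add.simps)
    then show ?thesis
      by (simp del: ec_add.simps add: y_def flip: True)
  qed
qed

lemma line_meets_eval: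
  assumes "line_meets l v x1 x2 x3"
  shows "f x - (l * x + v)\<^sup>2 = (x - x1) * (x - x2) * (x - x3)"
  using line_meetsD[OF assms] unfolding cubic_def by Groebner_Basis.algebra

lemma line_meets_tangentI:
  assumes "y\<^sup>2 = f x" and "3 * x\<^sup>2 + 2 * a * x + b = 2 * y * l"
  shows "line_meets l (y - l * x) x x (l\<^sup>2 - a - x - x)"
proof -
  have "x * x + x * (l\<^sup>2 - a - x - x) + x * (l\<^sup>2 - a - x - x) = b - 2 * l * (y - l * x)"
    using assms(2) by Groebner_Basis.algebra
  moreover have "x * x * (l\<^sup>2 - a - x - x) = (y - l * x)\<^sup>2 - c"
    using assms unfolding cubic_def by Groebner_Basis.algebra
  ultimately show ?thesis
    by (simp add: line_meets_iff)
qed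

lemma line_meets_chordI:
  assumes "x1 \<noteq> x2" and on: "(l * x1 + v)\<^sup>2 = f x1" "(l * x2 + v)\<^sup>2 = f x2"
  shows "line_meets l v x1 x2 (l\<^sup>2 - a - x1 - x2)" (is "line_meets _ _ _ _ ?x3")
proof -
  have "(x2 - x1) * (b - 2 * l * v - (x1 * x2 + x1 * ?x3 + x2 * ?x3)) = 0"
    using on unfolding cubic_def by Groebner_Basis.algebra
  then have second: "x1 * x2 + x1 * ?x3 + x2 * ?x3 = b - 2 * l * v"
    using \<open>x1 \<noteq> x2\<close> by simp
  moreover have "x1 * x2 * ?x3 = v\<^sup>2 - c"
    using on(1) second unfolding cubic_def by Groebner_Basis.algebra
  ultimately show ?thesis
    by (simp add: line_meets_iff)
qed

lemma line_through:
  assumes "Affine x1 y1 \<in> C" "Affine x2 y2 \<in> C" "Affine x2 y2 \<noteq> neg_point (Affine x1 y1)"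
  obtains l v x3 where "y1 = l * x1 + v" "y2 = l * x2 + v" "line_meets l v x1 x2 x3"
proof (cases "x1 = x2")
  case True
  have "(y2 - y1) * (y2 + y1) = 0"
    using assms(1,2) True by (simp add: algebra_simps power2_eq_square)
  moreover have "y2 \<noteq> - y1"
    using assms(3) True by simp
  ultimately have y: "y2 = y1" "y1 \<noteq> 0"
    by (auto simp: add_eq_0_iff)
  define l where "l = (3 * x1\<^sup>2 + 2 * a * x1 + b) / (2 * y1)"
  have "3 * x1\<^sup>2 + 2 * a * x1 + b = 2 * y1 * l"
    using y(2) by (simp add: l_def)
  with assms(1) have "line_meets l (y1 - l * x1) x1 x1 (l\<^sup>2 - a - x1 - x1)"
    by (intro line_meets_tangentI) simp_all
  with that[of l "y1 - l * x1"] True y(1) show ?thesis by simp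
next
  case False
  define l v where "l = (y2 - y1) / (x2 - x1)" and "v = y1 - l * x1"
  have "l * (x2 - x1) = y2 - y1"
    using False by (simp add: l_def)
  then have y: "y1 = l * x1 + v" "y2 = l * x2 + v"
    by (simp_all add: v_def algebra_simps)
  with assms(1,2) False have "line_meets l v x1 x2 (l\<^sup>2 - a - x1 - x2)"
    by (intro line_meets_chordI) simp_all
  with that y show ?thesis by blast
qed

text \<open>Avoiding the case distinctions of the chord-tangent formulas: sums of affine points that are
  not opposite are read off from the three intersections with a line.\<close>

lemma add_point_cases:
  assumes "P \<in> C" "Q \<in> C"
  obtains "P = Infinity" | "Q = Infinity" | "Q = neg_point P"
  | l v x1 x2 x3 where "P = Affine x1 (l * x1 + v)" "Q = Affine x2 (l * x2 + v)"
      "Q \<noteq> neg_point P" "P \<boxplus> Q = Affine x3 (- (l * x3 + v))" "line_meets l v x1 x2 x3"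
proof (cases "P = Infinity \<or> Q = Infinity \<or> Q = neg_point P")
  case False
  then obtain x1 y1 x2 y2 where PQ: "P = Affine x1 y1" "Q = Affine x2 y2"
    by (meson ec_point.exhaust)
  then obtain l v x3 where "y1 = l * x1 + v" "y2 = l * x2 + v" "line_meets l v x1 x2 x3"
    using line_through[of x1 y1 x2 y2] assms False by metis
  then show ?thesis
    using that(4) PQ False add_collinear by metis
qed (use that(1-3) in auto)

lemma line_meets_in_C:
  assumes "line_meets l v x1 x2 x3"
  shows "Affine x3 (l * x3 + v) \<in> C"
  using line_meets_eval[OF assms, of x3] by simp

lemma add_point_in_C:
  assumes "P \<in> C" "Q \<in> C"
  shows "P \<boxplus> Q \<in> C"
  using assms
proof (cases rule: add_point_cases)
  case (4 l v x1 x2 x3)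
  then show ?thesis
    using line_meets_in_C[of l v x1 x2 x3] by (simp del: ec_add.simps minus_add_distrib)
qed (use assms in auto)

lemma add_point_commute:
  assumes "P \<in> C" "Q \<in> C"
  shows "P \<boxplus> Q = Q \<boxplus> P"
  using assms
proof (cases rule: add_point_cases)
  case (4 l v x1 x2 x3)
  then show ?thesis
    using add_collinear[OF line_meets_commute[OF 4(5)]] by simp
qed auto

lemma add_neg_point_cancel:
  assumes "P \<in> C" "Q \<in> C"
  shows "(P \<boxplus> Q) \<boxplus> neg_point Q = P"
  using assms
proof (cases rule: add_point_cases)
  case (4 l v x1 x2 x3)
  have "Affine x3 (- (l * x3 + v)) \<boxplus> Affine x2 (- (l * x2 + v)) = Affine x1 (l * x1 + v)"
    using add_collinear[OF line_meets_reflect[OF 4(5)]] by simp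
  then show ?thesis
    unfolding 4(4) unfolding 4(1,2) by (simp del: ec_add.simps)
qed auto

lemma neg_point_add_cancel:
  assumes "P \<in> C" "Q \<in> C"
  shows "neg_point P \<boxplus> (P \<boxplus> Q) = Q"
  using add_neg_point_cancel[of Q P] assms by (simp add: add_point_commute add_point_in_C)

lemma add_point_cancel_right:
  assumes "P \<in> C" "Q \<in> C" "R \<in> C" "P \<boxplus> R = Q \<boxplus> R"
  shows "P = Q"
  using add_neg_point_cancel[of P R] add_neg_point_cancel[of Q R] assms by metis

definition parabola_meets :: "'a \<Rightarrow> 'a \<Rightarrow> 'a \<Rightarrow> 'a \<Rightarrow> 'a \<Rightarrow> 'a \<Rightarrow> 'a \<Rightarrow> bool" where
  "parabola_meets k l v x1 x2 x3 x4 \<longleftrightarrow>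
     [:c, b, a, 1:] - [:v, l, k:]\<^sup>2
       = - ([:k:]\<^sup>2 * ([:- x1, 1:] * [:- x2, 1:]) * ([:- x3, 1:] * [:- x4, 1:]))"

lemma parabola_meets_swap: "parabola_meets k l v x1 x2 x3 x4 \<Longrightarrow> parabola_meets k l v x3 x4 x1 x2"
  by (simp only: parabola_meets_def mult.assoc mult.commute mult.left_commute)

lemma parabola_meets_rotate: "parabola_meets k l v x1 x2 x3 x4 \<Longrightarrow> parabola_meets k l v x2 x3 x1 x4"
  by (simp only: parabola_meets_def mult.assoc mult.commute mult.left_commute)

lemma parabola_meetsD:
  assumes "parabola_meets k l v x1 x2 x3 x4"
  shows "1 - 2 * k * l = k\<^sup>2 * (x1 + x2 + x3 + x4)"
    "a - l\<^sup>2 - 2 * k * v = - k\<^sup>2 * (x1 * x2 + x1 * x3 + x1 * x4 + x2 * x3 + x2 * x4 + x3 * x4)"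
    "b - 2 * l * v = k\<^sup>2 * (x1 * x2 * x3 + x1 * x2 * x4 + x1 * x3 * x4 + x2 * x3 * x4)"
    "c - v\<^sup>2 = - k\<^sup>2 * (x1 * x2 * x3 * x4)"
  using assms unfolding parabola_meets_def
  by (auto simp add: power2_eq_square algebra_simps)

lemma parabola_chord:
  assumes "parabola_meets k l v x1 x2 x3 x4"
  shows "line_meets (l + k * (x1 + x2)) (v - k * (x1 * x2)) x1 x2 (k\<^sup>2 * (x1 * x2 + x3 * x4) - 2 * k * v)"
    (is "line_meets ?m ?w _ _ ?x")
proof -
  note vieta = parabola_meetsD[OF assms]
  have "?x = ?m\<^sup>2 - a - x1 - x2"
    using vieta by Groebner_Basis.algebra
  moreover have "x1 * x2 + x1 * ?x + x2 * ?x = b - 2 * ?m * ?w"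
    using vieta by Groebner_Basis.algebra
  moreover have "x1 * x2 * ?x = ?w\<^sup>2 - c"
    using vieta by Groebner_Basis.algebra
  ultimately show ?thesis
    unfolding line_meets_iff by blast
qed

lemma add_on_parabola:
  assumes k: "k \<noteq> 0" and meets: "parabola_meets k l v x1 x2 x3 x4"
  defines "p \<equiv> poly [:v, l, k:]"
  shows "(Affine x1 (p x1) \<boxplus> Affine x2 (p x2)) \<boxplus> Affine x3 (p x3) = Affine x4 (- p x4)"
proof -
  define x where "x = k\<^sup>2 * (x1 * x2 + x3 * x4) - 2 * k * v"
  define m w where "m = l + k * (x1 + x2)" and "w = v - k * (x1 * x2)"
  define n u where "n = l + k * (x3 + x4)" and "u = v - k * (x3 * x4)"
  have chords: "line_meets m w x1 x2 x" "line_meets n u x3 x4 x"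
    using parabola_chord[OF meets] parabola_chord[OF parabola_meets_swap[OF meets]]
    by (simp_all add: x_def m_def w_def n_def u_def add.commute)
  have p: "p x1 = m * x1 + w" "p x2 = m * x2 + w" "p x3 = n * x3 + u" "p x4 = n * x4 + u"
    by (simp_all add: p_def m_def w_def n_def u_def algebra_simps)
  have "k * (m * x + w + (n * x + u)) = 0"
    using parabola_meetsD(1)[OF meets] unfolding m_def w_def n_def u_def x_def
    by Groebner_Basis.algebra
  then have third: "- (m * x + w) = n * x + u"
    using k by (simp add: add_eq_0_iff)
  have "Affine x1 (p x1) \<boxplus> Affine x2 (p x2) = Affine x (n * x + u)"
    unfolding p add_collinear[OF chords(1)] third ..
  moreover have "line_meets n u x x3 x4"
    using chords(2) by (simp only: line_meets_def mult.assoc mult.commute mult.left_commute)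
  ultimately show ?thesis
    unfolding p using add_collinear by metis
qed

lemma parabola_meetsI:
  assumes line: "line_meets m w x1 x2 x"
    and linear: "1 - 2 * k * m + k\<^sup>2 * (x1 + x2) = k\<^sup>2 * (x3 + x4)"
    and const: "x + 2 * k * w + k\<^sup>2 * (x1 * x2) = k\<^sup>2 * (x3 * x4)"
  shows "parabola_meets k (m - k * (x1 + x2)) (w + k * (x1 * x2)) x1 x2 x3 x4"
proof -
  define F L q r :: "'a poly"
    where "F = [:c, b, a, 1:]" and "L = [:w, m:]" and "q = [:- x1, 1:] * [:- x2, 1:]" and "r = [:- x, 1:]"
  have "F - L\<^sup>2 = q * r"
    using line by (simp add: line_meets_def F_def L_def q_def r_def)
  then have residual: "F - (L + [:k:] * q)\<^sup>2 = q * (r - 2 * [:k:] * L - [:k:]\<^sup>2 * q)"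
    by Groebner_Basis.algebra
  have "r - 2 * [:k:] * L - [:k:]\<^sup>2 * q
      = [:- (x + 2 * k * w + k\<^sup>2 * (x1 * x2)), 1 - 2 * k * m + k\<^sup>2 * (x1 + x2), - k\<^sup>2:]"
    by (simp add: r_def L_def q_def numeral_poly power2_eq_square algebra_simps)
  also have "\<dots> = - ([:k:]\<^sup>2 * ([:- x3, 1:] * [:- x4, 1:]))"
    unfolding const linear by (simp add: power2_eq_square algebra_simps)
  finally have quotient: "r - 2 * [:k:] * L - [:k:]\<^sup>2 * q = - ([:k:]\<^sup>2 * ([:- x3, 1:] * [:- x4, 1:]))" .
  have "L + [:k:] * q = [:w + k * (x1 * x2), m - k * (x1 + x2), k:]"
    by (simp add: L_def q_def algebra_simps)
  then show ?thesis
    using residual unfolding quotient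
    by (simp only: parabola_meets_def F_def q_def mult_minus_right ac_simps)
qed

lemma parabola_through:
  assumes line: "line_meets m w x1 x2 x" and R: "Affine x3 y3 \<in> C"
    and ne: "x3 \<noteq> x1" "x3 \<noteq> x2" "y3 \<noteq> m * x3 + w"
  obtains k l v x4 where "k \<noteq> 0" "parabola_meets k l v x1 x2 x3 x4"
    "poly [:v, l, k:] x1 = m * x1 + w" "poly [:v, l, k:] x2 = m * x2 + w" "poly [:v, l, k:] x3 = y3"
proof -
  define k where "k = (y3 - (m * x3 + w)) / ((x3 - x1) * (x3 - x2))"
  define x4 where "x4 = (1 - 2 * k * m + k\<^sup>2 * (x1 + x2)) / k\<^sup>2 - x3"
  have k: "k \<noteq> 0" "y3 = m * x3 + w + k * ((x3 - x1) * (x3 - x2))"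
    using ne by (simp_all add: k_def)
  have linear: "1 - 2 * k * m + k\<^sup>2 * (x1 + x2) = k\<^sup>2 * (x3 + x4)"
    using k(1) by (simp add: x4_def field_simps)
  have "y3\<^sup>2 - (m * x3 + w)\<^sup>2 = (x3 - x1) * (x3 - x2) * (x3 - x)"
    using line_meets_eval[OF line, of x3] R by simp
  then have "(x3 - x1) * (x3 - x2)
      * ((x3 - x) - 2 * k * (m * x3 + w) - k\<^sup>2 * ((x3 - x1) * (x3 - x2))) = 0"
    unfolding k(2) by (simp add: algebra_simps power2_eq_square)
  then have root: "(x3 - x) - 2 * k * (m * x3 + w) - k\<^sup>2 * ((x3 - x1) * (x3 - x2)) = 0"
    using ne by simp
  have "x + 2 * k * w + k\<^sup>2 * (x1 * x2) = x3 * (1 - 2 * k * m + k\<^sup>2 * (x1 + x2)) - k\<^sup>2 * x3\<^sup>2"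
    using root by (simp add: algebra_simps power2_eq_square)
  also have "\<dots> = k\<^sup>2 * (x3 * x4)"
    unfolding linear by (simp add: algebra_simps power2_eq_square)
  finally have "parabola_meets k (m - k * (x1 + x2)) (w + k * (x1 * x2)) x1 x2 x3 x4"
    by (rule parabola_meetsI[OF line linear])
  then show ?thesis
    using that[OF k(1)] k(2) by (simp add: algebra_simps)
qed

lemma add_point_assoc_generic:
  assumes "P \<in> C" "Q \<in> C" "R \<in> C"
    and generic: "R \<notin> {Infinity, P, neg_point P, Q, neg_point Q, neg_point (P \<boxplus> Q)}"
  shows "(P \<boxplus> Q) \<boxplus> R = P \<boxplus> (Q \<boxplus> R)"
  using assms(1,2)
proof (cases rule: add_point_cases)
  case 3
  then show ?thesis
    using neg_point_add_cancel[of "neg_point P" R] assms by simp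
next
  case (4 m w x1 x2 x)
  obtain x3 y3 where R: "R = Affine x3 y3"
    using generic by (cases R) auto
  have distinct_x: "x3 \<noteq> u" if "Affine u v \<in> C" "R \<noteq> Affine u v" "R \<noteq> neg_point (Affine u v)" for u v
    using that assms(3) power2_eq_iff[of y3 v] by (auto simp: R)
  have ne: "x3 \<noteq> x1" "x3 \<noteq> x2"
    using distinct_x assms generic unfolding 4(1,2) by blast+
  have "y3 \<noteq> m * x3 + w"
  proof
    assume y3: "y3 = m * x3 + w"
    then have "x3 = x"
      using line_meets_eval[OF 4(5), of x3] assms(3) ne by (simp add: R)
    then show False
      using generic by (simp add: R y3 4(4))
  qed
  with ne obtain k l v x4 where "k \<noteq> 0" "parabola_meets k l v x1 x2 x3 x4"
    "poly [:v, l, k:] x1 = m * x1 + w" "poly [:v, l, k:] x2 = m * x2 + w" "poly [:v, l, k:] x3 = y3"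
    using parabola_through[OF 4(5) assms(3)[unfolded R]] by blast
  then have "(P \<boxplus> Q) \<boxplus> R = (Q \<boxplus> R) \<boxplus> P"
    using add_on_parabola[of k l v x1 x2 x3 x4] add_on_parabola[of k l v x2 x3 x1 x4]
      parabola_meets_rotate[of k l v x1 x2 x3 x4]
    unfolding 4(1,2) R by (simp del: ec_add.simps)
  also have "\<dots> = P \<boxplus> (Q \<boxplus> R)"
    using assms by (intro add_point_commute add_point_in_C)
  finally show ?thesis .
qed auto

lemma infinite_C: "infinite C"
proof
  assume "finite C"
  define x_coord where "x_coord P = (case P of Infinity \<Rightarrow> 0 | Affine x y \<Rightarrow> x)" for P :: "'a ec_point"
  have "x \<in> x_coord ` C" for x
  proof -
    obtain y where "y\<^sup>2 = f x"
      using nth_root_exists[of 2 "f x"] by auto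
    then show ?thesis
      by (intro image_eqI[of _ _ "Affine x y"]) (auto simp: x_coord_def)
  qed
  then show False
    using finite_surj[OF \<open>finite C\<close>, of UNIV x_coord] infinite_UNIV_char_0 by blast
qed

lemma add_point_assoc:
  assumes [simp]: "P \<in> C" "Q \<in> C" "R \<in> C"
  shows "(P \<boxplus> Q) \<boxplus> R = P \<boxplus> (Q \<boxplus> R)"
proof -
  \<comment> \<open>Adding a generic point to both sides avoids all degenerate cases.\<close>
  define exceptional where
    "exceptional P Q = {Infinity, P, neg_point P, Q, neg_point Q, neg_point (P \<boxplus> Q)}" for P Q
  define bad where "bad = exceptional (P \<boxplus> Q) R \<union> (\<lambda>T. neg_point R \<boxplus> T) ` exceptional P Q
     \<union> exceptional Q R \<union> exceptional P (Q \<boxplus> R)"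
  have "finite bad"
    by (simp add: bad_def exceptional_def)
  then obtain T where T [simp]: "T \<in> C" and "T \<notin> bad"
    using infinite_C by (meson finite_subset subsetI)
  then have generic: "T \<notin> exceptional (P \<boxplus> Q) R" "R \<boxplus> T \<notin> exceptional P Q"
      "T \<notin> exceptional Q R" "T \<notin> exceptional P (Q \<boxplus> R)"
    using neg_point_add_cancel[of R T] unfolding bad_def by force+
  note assoc = add_point_assoc_generic[folded exceptional_def]
  note [simp] = add_point_in_C
  have "((P \<boxplus> Q) \<boxplus> R) \<boxplus> T = (P \<boxplus> Q) \<boxplus> (R \<boxplus> T)"
    by (rule assoc) (use generic in auto)
  also have "\<dots> = P \<boxplus> (Q \<boxplus> (R \<boxplus> T))"
    by (rule assoc) (use generic in auto)
  also have "Q \<boxplus> (R \<boxplus> T) = (Q \<boxplus> R) \<boxplus> T"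
    by (rule assoc[symmetric]) (use generic in auto)
  also have "P \<boxplus> ((Q \<boxplus> R) \<boxplus> T) = (P \<boxplus> (Q \<boxplus> R)) \<boxplus> T"
    by (rule assoc[symmetric]) (use generic in auto)
  finally show ?thesis
    by (rule add_point_cancel_right[rotated 3]) auto
qed

end

lemma ec_points_iff:
  "P \<in> ec_points E L \<longleftrightarrow> P \<in> ec_points E UNIV \<and> (\<forall>x y. P = Affine x y \<longrightarrow> x \<in> L \<and> y \<in> L)"
  by (auto simp: ec_points_def)

lemma mordell_weil_group_simps [simp]:
  "carrier (mordell_weil_group E L) = ec_points E L" "\<one>\<^bsub>mordell_weil_group E L\<^esub> = Infinity"
  "P \<otimes>\<^bsub>mordell_weil_group E L\<^esub> Q = ec_add E P Q"
  by (simp_all add: mordell_weil_group_def)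

lemma Infinity_in_ec_points [simp]: "Infinity \<in> ec_points E L"
  by (simp add: ec_points_def)

context nonsingular_cubic
begin

context
  fixes L :: "'a set"
  assumes L: "is_subfield L" and abc: "a \<in> L" "b \<in> L" "c \<in> L"
begin

lemma add_point_in_ec_points:
  assumes "P \<in> points L" "Q \<in> points L"
  shows "P \<boxplus> Q \<in> points L"
proof -
  have "P \<boxplus> Q \<in> C"
    using assms ec_points_iff add_point_in_C by blast
  moreover have "x \<in> L \<and> y \<in> L" if "P \<boxplus> Q = Affine x y" for x y
  proof (cases P; cases Q)
    fix x1 y1 x2 y2 assume PQ: "P = Affine x1 y1" "Q = Affine x2 y2"
    then have "x1 \<in> L" "y1 \<in> L" "x2 \<in> L" "y2 \<in> L"
      using assms ec_points_iff[of _ _ L] by auto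
    then show ?thesis
      using that abc unfolding PQ
      by (auto simp: Let_def split: if_splits intro!: subfield_closed[OF L])
  qed (use that assms ec_points_iff[of _ _ L] in auto)
  ultimately show ?thesis
    by (subst ec_points_iff) blast
qed

lemma neg_point_in_ec_points:
  assumes "P \<in> points L"
  shows "neg_point P \<in> points L"
  using assms subfield_closed(9)[OF L] by (cases P) (auto simp: ec_points_def)

lemma comm_group_cubic_curve: "comm_group (point_group L)"
proof (rule comm_groupI; simp only: mordell_weil_group_simps)
  note on_C = ec_points_iff[THEN iffD1, THEN conjunct1]
  fix P assume P: "P \<in> points L"
  show "\<exists>Q\<in>points L. Q \<boxplus> P = Infinity"
    using neg_point_in_ec_points[OF P] add_neg_point(2) by blast
  fix Q assume Q: "Q \<in> points L"
  show "P \<boxplus> Q = Q \<boxplus> P"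
    using P Q by (intro add_point_commute on_C)
  show "P \<boxplus> Q \<in> points L"
    by (rule add_point_in_ec_points[OF P Q])
  fix R assume "R \<in> points L"
  then show "P \<boxplus> Q \<boxplus> R = P \<boxplus> (Q \<boxplus> R)"
    using P Q by (intro add_point_assoc on_C)
qed simp_all

lemma inv_cubic_curve:
  assumes "P \<in> points L"
  shows "inv\<^bsub>point_group L\<^esub> P = neg_point P"
proof -
  interpret G: comm_group "point_group L"
    by (rule comm_group_cubic_curve)
  show ?thesis
    using assms neg_point_in_ec_points[OF assms] by (intro G.inv_equality) simp_all
qed

end

end

section \<open>Completing the square\<close>

definition completed_a2 :: "'a::field weierstrass \<Rightarrow> 'a" where
  "completed_a2 E = wa2 E + (wa1 E)\<^sup>2 / 4"

definition completed_a4 :: "'a::field weierstrass \<Rightarrow> 'a" where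
  "completed_a4 E = wa4 E + wa1 E * wa3 E / 2"

definition completed_a6 :: "'a::field weierstrass \<Rightarrow> 'a" where
  "completed_a6 E = wa6 E + (wa3 E)\<^sup>2 / 4"

abbreviation square_completed :: "'a::field weierstrass \<Rightarrow> 'a weierstrass" where
  "square_completed E \<equiv> cubic_curve (completed_a2 E) (completed_a4 E) (completed_a6 E)"

fun uncomplete_square :: "'a::field weierstrass \<Rightarrow> 'a ec_point \<Rightarrow> 'a ec_point" where
  "uncomplete_square E Infinity = Infinity"
| "uncomplete_square E (Affine x y) = Affine x (y - (wa1 E * x + wa3 E) / 2)"

lemma completed_coeffs_in:
  fixes E :: "'a::field_char_0 weierstrass"
  assumes K: "is_subfield K" and E: "elliptic_curve_over K E"
  shows "completed_a2 E \<in> K" "completed_a4 E \<in> K" "completed_a6 E \<in> K"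
  using E unfolding elliptic_curve_over_def completed_a2_def completed_a4_def completed_a6_def
  by (auto intro!: subfield_closed[OF K])

lemma nonsingular_square_completed:
  fixes E :: "'a::{field_char_0, alg_closed_field} weierstrass"
  assumes "discriminant E \<noteq> 0"
  shows "nonsingular_cubic (completed_a2 E) (completed_a4 E) (completed_a6 E)"
proof
  define a b c where abc: "a = completed_a2 E" "b = completed_a4 E" "c = completed_a6 E"
  fix x
  assume root: "cubic (completed_a2 E) (completed_a4 E) (completed_a6 E) x = 0"
  show "3 * x\<^sup>2 + 2 * completed_a2 E * x + completed_a4 E \<noteq> 0"
    unfolding abc[symmetric]
  proof
    assume double: "3 * x\<^sup>2 + 2 * a * x + b = 0"
    have "discriminant E = 16 * (a\<^sup>2 * b\<^sup>2 - 4 * b ^ 3 - 4 * a ^ 3 * c - 27 * c\<^sup>2 + 18 * a * b * c)"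
      unfolding discriminant_def Let_def abc completed_a2_def completed_a4_def completed_a6_def
      by (simp add: field_simps power2_eq_square power3_eq_cube)
    also have "\<dots> = 0"
      using root double unfolding cubic_def abc[symmetric] by Groebner_Basis.algebra
    finally show False
      using assms by simp
  qed
qed

lemma ec_slope_uncomplete_square:
  fixes E :: "'a::{field_char_0, alg_closed_field} weierstrass"
  assumes disc: "discriminant E \<noteq> 0"
    and line: "nonsingular_cubic.line_meets (completed_a2 E) (completed_a4 E) (completed_a6 E) l v x1 x2 x3"
    and ne: "\<not> (x1 = x2 \<and> l * x1 + v + (l * x2 + v) = 0)"
  shows "ec_slope E x1 (l * x1 + v - (wa1 E * x1 + wa3 E) / 2) x2 (l * x2 + v - (wa1 E * x2 + wa3 E) / 2)
    = l - wa1 E / 2"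
proof -
  interpret nonsingular_cubic "completed_a2 E" "completed_a4 E" "completed_a6 E"
    by (rule nonsingular_square_completed[OF disc])
  define y where "y x = l * x + v - (wa1 E * x + wa3 E) / 2" for x
  have "ec_slope E x1 (y x1) x2 (y x2) = l - wa1 E / 2"
  proof (cases "x1 = x2")
    case True
    define z where "z = l * x1 + v"
    have "z + z \<noteq> 0"
      using ne True unfolding z_def by blast
    have "3 * x1\<^sup>2 + 2 * wa2 E * x1 + wa4 E - wa1 E * y x1
        = 3 * x1\<^sup>2 + 2 * completed_a2 E * x1 + completed_a4 E - wa1 E * z"
      by (simp add: completed_a2_def completed_a4_def y_def z_def field_simps power2_eq_square)
    also have "\<dots> = (l - wa1 E / 2) * (2 * z)"
      using line_meets_tangent[of l v x1 x3] line True by (simp add: z_def algebra_simps)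
    finally have "3 * x1\<^sup>2 + 2 * wa2 E * x1 + wa4 E - wa1 E * y x1 = (l - wa1 E / 2) * (2 * z)" .
    moreover have "2 * y x1 + wa1 E * x1 + wa3 E = 2 * z"
      by (simp add: y_def z_def field_simps)
    ultimately show ?thesis
      using \<open>z + z \<noteq> 0\<close> by (simp only: ec_slope_def True if_True) simp
  next
    case False
    then show ?thesis
      by (simp add: ec_slope_def y_def field_simps)
  qed
  then show ?thesis
    by (simp add: y_def)
qed

lemma uncomplete_square_add:
  fixes E :: "'a::{field_char_0, alg_closed_field} weierstrass"
  assumes disc: "discriminant E \<noteq> 0"
    and PQ: "P \<in> ec_points (square_completed E) UNIV" "Q \<in> ec_points (square_completed E) UNIV"
  shows "uncomplete_square E (ec_add (square_completed E) P Q)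
    = ec_add E (uncomplete_square E P) (uncomplete_square E Q)"
proof -
  interpret nonsingular_cubic "completed_a2 E" "completed_a4 E" "completed_a6 E"
    by (rule nonsingular_square_completed[OF disc])
  from PQ show ?thesis
  proof (cases rule: add_point_cases)
    case 3
    then show ?thesis
      by (cases P) (simp_all add: field_simps)
  next
    case (4 l v x1 x2 x3)
    define m where "m = l - wa1 E / 2"
    define y1 y2 where
      "y1 = l * x1 + v - (wa1 E * x1 + wa3 E) / 2" "y2 = l * x2 + v - (wa1 E * x2 + wa3 E) / 2"
    have not_opposite: "\<not> (x1 = x2 \<and> l * x1 + v + (l * x2 + v) = 0)"
      using 4(1-3) by (auto simp: add_eq_0_iff)
    moreover have "y1 + y2 + wa1 E * x2 + wa3 E = l * x1 + v + (l * x2 + v)" if "x1 = x2"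
      using that by (simp add: y1_y2_def)
    ultimately have "\<not> (x1 = x2 \<and> y1 + y2 + wa1 E * x2 + wa3 E = 0)"
      by metis
    moreover have "m = ec_slope E x1 y1 x2 y2"
      unfolding m_def y1_y2_def by (rule ec_slope_uncomplete_square[OF disc 4(5) not_opposite, symmetric])
    moreover have "m\<^sup>2 + wa1 E * m = l\<^sup>2 - (wa1 E)\<^sup>2 / 4"
      by (simp add: m_def field_simps power2_eq_square)
    then have "x3 = m\<^sup>2 + wa1 E * m - wa2 E - x1 - x2"
      using line_meetsD(1)[OF 4(5)] by (simp add: completed_a2_def)
    ultimately have "ec_add E (Affine x1 y1) (Affine x2 y2) = Affine x3 (- (m + wa1 E) * x3 - (y1 - m * x1) - wa3 E)"
      by (rule ec_add_Affine)
    also have "\<dots> = uncomplete_square E (Affine x3 (- (l * x3 + v)))"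
      by (simp add: m_def y1_y2_def field_simps)
    finally show ?thesis
      unfolding 4(4) unfolding 4(1,2) y1_y2_def by simp
  qed simp_all
qed

lemma uncomplete_square_in_ec_points_iff:
  fixes E :: "'a::field_char_0 weierstrass"
  assumes L: "is_subfield L" and E: "elliptic_curve_over L E"
  shows "uncomplete_square E P \<in> ec_points E L \<longleftrightarrow> P \<in> ec_points (square_completed E) L"
proof (cases P)
  case (Affine x y)
  define s where "s = (wa1 E * x + wa3 E) / 2"
  have "(y - s)\<^sup>2 + wa1 E * x * (y - s) + wa3 E * (y - s) = (y - s)\<^sup>2 + 2 * s * (y - s)"
    by (simp add: s_def field_simps)
  also have "\<dots> = y\<^sup>2 - s\<^sup>2"
    by (simp add: algebra_simps power2_eq_square)
  finally have "(y - s)\<^sup>2 + wa1 E * x * (y - s) + wa3 E * (y - s)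
      - (x ^ 3 + wa2 E * x\<^sup>2 + wa4 E * x + wa6 E)
      = y\<^sup>2 - (x ^ 3 + completed_a2 E * x\<^sup>2 + completed_a4 E * x + completed_a6 E)"
    by (simp add: s_def completed_a2_def completed_a4_def completed_a6_def field_simps power2_eq_square)
  then have "(y - s)\<^sup>2 + wa1 E * x * (y - s) + wa3 E * (y - s) = x ^ 3 + wa2 E * x\<^sup>2 + wa4 E * x + wa6 E
      \<longleftrightarrow> y\<^sup>2 = x ^ 3 + completed_a2 E * x\<^sup>2 + completed_a4 E * x + completed_a6 E"
    by (rule diff_eq_diff_eq)
  moreover have "y - s \<in> L \<longleftrightarrow> y \<in> L" if "x \<in> L"
  proof -
    have s: "s \<in> L"
      using E that unfolding s_def elliptic_curve_over_def by (auto intro!: subfield_closed[OF L])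
    then show ?thesis
      using subfield_closed(5,6)[OF L _ s] by (metis diff_add_cancel)
  qed
  ultimately show ?thesis
    unfolding Affine by (auto simp: ec_points_def s_def)
qed simp

lemma uncomplete_square_iso:
  fixes E :: "'a::{field_char_0, alg_closed_field} weierstrass"
  assumes L: "is_subfield L" and E: "elliptic_curve_over L E"
  shows "uncomplete_square E \<in> iso (mordell_weil_group (square_completed E) L) (mordell_weil_group E L)"
proof (rule isoI)
  have disc: "discriminant E \<noteq> 0"
    using E by (simp add: elliptic_curve_over_def)
  note in_iff = uncomplete_square_in_ec_points_iff[OF L E]
  show "uncomplete_square E \<in> hom (mordell_weil_group (square_completed E) L) (mordell_weil_group E L)"
  proof (rule homI; simp only: mordell_weil_group_simps in_iff)
    fix P Q
    assume "P \<in> ec_points (square_completed E) L" "Q \<in> ec_points (square_completed E) L"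
    then show "uncomplete_square E (ec_add (square_completed E) P Q)
        = ec_add E (uncomplete_square E P) (uncomplete_square E Q)"
      using ec_points_iff by (blast intro: uncomplete_square_add[OF disc])
  qed
  have "inj_on (uncomplete_square E) A" for A
  proof (rule inj_onI)
    show "P = Q" if "uncomplete_square E P = uncomplete_square E Q" for P Q
      using that by (cases P; cases Q) auto
  qed
  moreover have "\<exists>Q. P = uncomplete_square E Q" for P
  proof (cases P)
    case (Affine x y)
    then show ?thesis
      by (intro exI[of _ "Affine x (y + (wa1 E * x + wa3 E) / 2)"]) simp
  qed (metis uncomplete_square.simps(1))
  then have "uncomplete_square E ` ec_points (square_completed E) L = ec_points E L"
    using in_iff by fast
  ultimately show "bij_betw (uncomplete_square E) (carrier (mordell_weil_group (square_completed E) L))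
     (carrier (mordell_weil_group E L))"
    by (simp add: bij_betw_def)
qed

lemma comm_group_square_completed:
  fixes E :: "'a::{field_char_0, alg_closed_field} weierstrass"
  assumes L: "is_subfield L" and E: "elliptic_curve_over L E"
  shows "comm_group (mordell_weil_group (square_completed E) L)"
proof -
  interpret nonsingular_cubic "completed_a2 E" "completed_a4 E" "completed_a6 E"
    using E by (intro nonsingular_square_completed) (simp add: elliptic_curve_over_def)
  show ?thesis
    by (rule comm_group_cubic_curve[OF L completed_coeffs_in[OF L E]])
qed

lemma comm_group_mordell_weil_group:
  fixes E :: "'a::{field_char_0, alg_closed_field} weierstrass"
  assumes "is_subfield L" "elliptic_curve_over L E"
  shows "comm_group (mordell_weil_group E L)"
  using comm_group.iso_imp_img_comm_group[OF comm_group_square_completed uncomplete_square_iso] assms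
  by (simp add: mordell_weil_group_def)

section \<open>Rank\<close>

lemma (in comm_group) finprod_in_subgroup:
  assumes H: "subgroup H G" and g: "\<And>i. i \<in> I \<Longrightarrow> g i \<in> H"
  shows "finprod G g I \<in> H"
  using g
proof (induction I rule: infinite_finite_induct)
  case (insert i I)
  then show ?case
    using subgroup.subset[OF H] subgroup.m_closed[OF H] by (subst finprod_insert) auto
qed (use subgroup.one_closed[OF H] in auto)

lemma (in group_hom) hom_finprod:
  assumes "comm_group G" "comm_group H" and g: "g \<in> I \<rightarrow> carrier G"
  shows "h (finprod G g I) = finprod H (h \<circ> g) I"
proof -
  interpret G: comm_group G by fact
  interpret H: comm_group H by fact
  show ?thesis
    using g by (induction I rule: infinite_finite_induct) (auto simp: Pi_iff)
qed

lemma abelian_group_rank_le_of_inj_hom: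
  assumes G: "comm_group G" and H: "comm_group H" and h: "h \<in> hom G H" and inj: "inj_on h (carrier G)"
  shows "abelian_group_rank G \<le> abelian_group_rank H"
proof -
  interpret G: comm_group G by (rule G)
  interpret H: comm_group H by (rule H)
  interpret group_hom G H h
    using h by unfold_locales
  have "int_independent H (h ` S)" if S: "int_independent G S" for S
    unfolding int_independent_def
  proof (intro conjI allI impI)
    have SG: "finite S" "S \<subseteq> carrier G" "inj_on h S"
      using S by (auto simp: int_independent_def intro: inj_on_subset[OF inj])
    then show "finite (h ` S)" "h ` S \<subseteq> carrier H"
      by auto
    fix n :: "'c \<Rightarrow> int"
    assume "finprod H (\<lambda>y. y [^]\<^bsub>H\<^esub> n y) (h ` S) = \<one>\<^bsub>H\<^esub>"
    also have "finprod H (\<lambda>y. y [^]\<^bsub>H\<^esub> n y) (h ` S) = finprod H (\<lambda>x. h x [^]\<^bsub>H\<^esub> n (h x)) S"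
      using SG by (intro H.finprod_reindex) auto
    also have "\<dots> = h (finprod G (\<lambda>x. x [^]\<^bsub>G\<^esub> n (h x)) S)"
      using SG(2) by (subst hom_finprod[OF G H]) (auto simp: hom_int_pow intro!: H.finprod_cong')
    finally have "h (finprod G (\<lambda>x. x [^]\<^bsub>G\<^esub> n (h x)) S) = h \<one>\<^bsub>G\<^esub>"
      by simp
    then have "finprod G (\<lambda>x. x [^]\<^bsub>G\<^esub> n (h x)) S = \<one>\<^bsub>G\<^esub>"
      by (rule inj_onD[OF inj]) (use SG(2) in \<open>auto intro!: G.finprod_closed\<close>)
    then show "\<forall>y\<in>h ` S. n y = 0"
      using S by (auto simp: int_independent_def)
  qed
  moreover have "card (h ` S) = card S" if "int_independent G S" for S
    using that by (auto simp: int_independent_def intro!: card_image inj_on_subset[OF inj])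
  ultimately show ?thesis
    unfolding abelian_group_rank_def by (intro SUP_least) (auto intro!: SUP_upper2)
qed

lemma rank_square_completed_le:
  fixes E :: "'a::{field_char_0, alg_closed_field} weierstrass"
  assumes L: "is_subfield L" and E: "elliptic_curve_over L E"
  shows "abelian_group_rank (mordell_weil_group (square_completed E) L)
    \<le> abelian_group_rank (mordell_weil_group E L)"
  using uncomplete_square_iso[OF L E]
  by (intro abelian_group_rank_le_of_inj_hom comm_group_square_completed[OF L E]
      comm_group_mordell_weil_group[OF L E]) (auto simp: iso_def bij_betw_def)

lemma rank_mono:
  fixes E :: "'a::{field_char_0, alg_closed_field} weierstrass"
  assumes L: "is_subfield L" and M: "is_subfield M" and E: "elliptic_curve_over L E" and LM: "L \<subseteq> M"
  shows "abelian_group_rank (mordell_weil_group E L) \<le> abelian_group_rank (mordell_weil_group E M)"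
proof (rule abelian_group_rank_le_of_inj_hom[of _ _ id])
  have "elliptic_curve_over M E"
    using E LM by (auto simp: elliptic_curve_over_def)
  then show "comm_group (mordell_weil_group E M)"
    by (rule comm_group_mordell_weil_group[OF M])
  show "id \<in> hom (mordell_weil_group E L) (mordell_weil_group E M)"
    using LM by (auto simp: hom_def ec_points_def)
qed (simp_all add: comm_group_mordell_weil_group[OF L E])

lemma (in comm_group) int_independent_insert:
  assumes H: "subgroup H G" and S: "int_independent G S" "S \<subseteq> H"
    and x: "x \<in> carrier G" "\<And>k::int. k \<noteq> 0 \<Longrightarrow> x [^] k \<notin> H"
  shows "x \<notin> S" "int_independent G (insert x S)"
proof -
  have SG: "finite S" "S \<subseteq> carrier G"
    using S by (auto simp: int_independent_def)
  show xS: "x \<notin> S"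
    using x(2)[of 1] x(1) S(2) by auto
  show "int_independent G (insert x S)"
    unfolding int_independent_def
  proof (intro conjI allI impI)
    fix n :: "'a \<Rightarrow> int"
    define p where "p = finprod G (\<lambda>s. s [^] n s) S"
    have "p \<in> H"
      unfolding p_def using S(2) by (intro finprod_in_subgroup[OF H] subgroup_int_pow_closed[OF H]) auto
    then have p: "p \<in> carrier G" "inv p \<in> H"
      using subgroup.subset[OF H] subgroup.m_inv_closed[OF H] by auto
    assume "finprod G (\<lambda>s. s [^] n s) (insert x S) = \<one>"
    moreover have "finprod G (\<lambda>s. s [^] n s) (insert x S) = x [^] n x \<otimes> p"
      unfolding p_def using SG x(1) xS by (intro finprod_insert) auto
    ultimately have relation: "x [^] n x \<otimes> p = \<one>"
      by simp
    then have "x [^] n x = inv p"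
      using p(1) x(1) by (metis inv_equality int_pow_closed)
    then have nx: "n x = 0"
      using x(2) p(2) by metis
    then have "p = \<one>"
      using relation p(1) by simp
    then show "\<forall>s\<in>insert x S. n s = 0"
      using S(1) nx unfolding int_independent_def p_def by blast
  qed (use SG x(1) in auto)
qed

lemma (in comm_group) rank_infinite:
  assumes subgroups: "\<And>H. H \<in> \<H> \<Longrightarrow> subgroup H G" and "\<H> \<noteq> {}"
    and enlarge: "\<And>H. H \<in> \<H> \<Longrightarrow> \<exists>H'\<in>\<H>. \<exists>x\<in>H'. H \<subseteq> H' \<and> (\<forall>k::int. k \<noteq> 0 \<longrightarrow> x [^] k \<notin> H)"
  shows "abelian_group_rank G = \<infinity>"
proof -
  have independent: "\<exists>H\<in>\<H>. \<exists>S\<subseteq>H. int_independent G S \<and> card S = n" for n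
  proof (induction n)
    case 0
    obtain H where "H \<in> \<H>"
      using \<open>\<H> \<noteq> {}\<close> by blast
    moreover have "int_independent G {}"
      by (simp add: int_independent_def)
    ultimately show ?case
      by (intro bexI[of _ H] exI[of _ "{}"]) simp_all
  next
    case (Suc n)
    then obtain H S where HS: "H \<in> \<H>" "S \<subseteq> H" "int_independent G S" "card S = n"
      by blast
    obtain H' x where H': "H' \<in> \<H>" "x \<in> H'" "H \<subseteq> H'" "\<And>k::int. k \<noteq> 0 \<Longrightarrow> x [^] k \<notin> H"
      using enlarge[OF HS(1)] by blast
    have "x \<in> carrier G"
      using subgroup.subset[OF subgroups[OF H'(1)]] H'(2) by blast
    note insert = int_independent_insert[OF subgroups[OF HS(1)] HS(3,2) this H'(4)]
    have "card (insert x S) = Suc n"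
      using insert HS(3,4) by (simp add: int_independent_def)
    then show ?case
      using insert(2) H' HS(2) by (intro bexI[of _ H'] exI[of _ "insert x S"]) auto
  qed
  have le: "enat n \<le> abelian_group_rank G" for n
    using independent[of n] unfolding abelian_group_rank_def by (auto intro: SUP_upper2)
  show ?thesis
  proof (cases "abelian_group_rank G")
    case (enat m)
    then show ?thesis
      using le[of "Suc m"] by simp
  qed
qed

section \<open>Galois groups and quadratic extensions\<close>

context
  fixes K M :: "'a::field_char_0 set" and f :: "'a \<Rightarrow> 'a"
  assumes M: "is_subfield M" and f: "f \<in> carrier (Gal M K)"
begin

lemma
  shows Gal_closed: "x \<in> M \<Longrightarrow> f x \<in> M"
    and Gal_fixed: "x \<in> K \<Longrightarrow> f x = x"
    and Gal_add: "x \<in> M \<Longrightarrow> y \<in> M \<Longrightarrow> f (x + y) = f x + f y"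
    and Gal_mult: "x \<in> M \<Longrightarrow> y \<in> M \<Longrightarrow> f (x * y) = f x * f y"
    and Gal_eq_iff: "x \<in> M \<Longrightarrow> y \<in> M \<Longrightarrow> f x = f y \<longleftrightarrow> x = y"
proof -
  have bij: "bij_betw f M M"
    using f by (simp add: Gal_def Bij_def)
  then show "x \<in> M \<Longrightarrow> f x \<in> M"
    using bij_betwE by blast
  show "x \<in> M \<Longrightarrow> y \<in> M \<Longrightarrow> f x = f y \<longleftrightarrow> x = y"
    using bij by (auto simp: bij_betw_def dest: inj_onD)
qed (use f in \<open>auto simp: Gal_def\<close>)

lemma
  shows Gal_0: "f 0 = 0" and Gal_1: "f 1 = 1"
    and Gal_uminus: "x \<in> M \<Longrightarrow> f (- x) = - f x"
    and Gal_diff: "x \<in> M \<Longrightarrow> y \<in> M \<Longrightarrow> f (x - y) = f x - f y"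
proof -
  note closed = subfield_closed[OF M]
  show zero: "f 0 = 0"
    using Gal_add[of 0 0] closed(1) by simp
  then have "f 1 \<noteq> 0"
    using Gal_eq_iff[of 1 0] closed(1,2) by simp
  then show "f 1 = 1"
    using Gal_mult[of 1 1] closed(2) by simp
  show uminus: "f (- x) = - f x" if "x \<in> M" for x
    using Gal_add[OF that, of "- x"] that closed by (simp add: zero add_eq_0_iff)
  show "f (x - y) = f x - f y" if "x \<in> M" "y \<in> M"
    using Gal_add[of x "- y"] uminus[of y] that closed(9) by simp
qed

lemma
  shows Gal_inverse: "x \<in> M \<Longrightarrow> f (inverse x) = inverse (f x)"
    and Gal_divide: "x \<in> M \<Longrightarrow> y \<in> M \<Longrightarrow> f (x / y) = f x / f y"
    and Gal_power: "x \<in> M \<Longrightarrow> f (x ^ n) = f x ^ n"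
    and Gal_of_nat: "f (of_nat n) = of_nat n"
    and Gal_numeral: "f (numeral k) = numeral k"
proof -
  note closed = subfield_closed[OF M]
  show inverse: "f (inverse x) = inverse (f x)" if "x \<in> M" for x
  proof (cases "x = 0")
    case False
    then have "f x * f (inverse x) = 1"
      using Gal_mult[of x "inverse x"] that closed(10) Gal_1 by simp
    then show ?thesis by (metis inverse_unique)
  qed (simp add: Gal_0)
  show "f (x / y) = f x / f y" if "x \<in> M" "y \<in> M"
    using Gal_mult[of x "inverse y"] inverse[of y] that closed(10) by (simp add: divide_inverse)
  show "f (x ^ n) = f x ^ n" if "x \<in> M"
    by (induction n) (use that closed Gal_mult Gal_1 in auto)
  show of_nat: "f (of_nat n) = of_nat n" for n
    by (induction n) (use closed Gal_0 Gal_add Gal_1 in auto)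
  show "f (numeral k) = numeral k"
    using of_nat[of "numeral k"] by simp
qed

lemmas Gal_hom = Gal_closed Gal_fixed Gal_add Gal_mult Gal_0 Gal_1 Gal_uminus Gal_diff Gal_inverse
  Gal_divide Gal_power Gal_of_nat Gal_numeral

end

definition quadratic_extension :: "'a::field set \<Rightarrow> 'a \<Rightarrow> 'a set" where
  "quadratic_extension F y = {u + v * y | u v. u \<in> F \<and> v \<in> F}"

locale quadratic_generator =
  fixes F :: "'a::field_char_0 set" and y :: 'a
  assumes subfield_F: "is_subfield F" and square_in: "y\<^sup>2 \<in> F" and not_in: "y \<notin> F"
begin

abbreviation "M \<equiv> quadratic_extension F y"

lemmas F_closed = subfield_closed[OF subfield_F]

lemma in_extension_iff: "x \<in> M \<longleftrightarrow> (\<exists>u\<in>F. \<exists>v\<in>F. x = u + v * y)"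
  unfolding quadratic_extension_def by blast

lemma in_extensionI: "u \<in> F \<Longrightarrow> v \<in> F \<Longrightarrow> u + v * y \<in> M"
  using in_extension_iff by blast

lemma extension_superset: "F \<subseteq> M" "y \<in> M"
  using in_extensionI[of _ 0] in_extensionI[of 0 1] F_closed(1,2) by auto

lemma coordinates_unique:
  assumes in_F: "u \<in> F" "v \<in> F" "u' \<in> F" "v' \<in> F" and eq: "u + v * y = u' + v' * y"
  shows "u = u'" "v = v'"
proof -
  show "v = v'"
  proof (rule ccontr)
    assume "v \<noteq> v'"
    then have "y = (u' - u) / (v - v')"
      using eq by (simp add: field_simps)
    also have "\<dots> \<in> F"
      using in_F by (intro F_closed)
    finally show False
      using not_in by blast
  qed
  then show "u = u'"
    using eq by simp
qed

lemma extension_mult: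
  "(u + v * y) * (u' + v' * y) = (u * u' + v * v' * y\<^sup>2) + (u * v' + v * u') * y"
  by (simp add: algebra_simps power2_eq_square)

lemma inverse_in_extension:
  assumes uv: "u \<in> F" "v \<in> F"
  shows "inverse (u + v * y) \<in> M"
proof -
  define n where "n = u\<^sup>2 - v\<^sup>2 * y\<^sup>2"
  have n: "(u + v * y) * (u - v * y) = n"
    by (simp add: n_def algebra_simps power2_eq_square)
  show ?thesis
  proof (cases "n = 0")
    case True
    then have "u + v * y = 0 + 0 * y \<or> u + (- v) * y = 0 + 0 * y"
      using n by auto
    then have "u = 0" "v = 0"
      using coordinates_unique[of u v 0 0] coordinates_unique[of u "- v" 0 0] uv F_closed by auto
    then show ?thesis
      using extension_superset F_closed(1) by auto
  next
    case False
    then have "(u + v * y) * ((u - v * y) / n) = 1"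
      using n by (simp only: times_divide_eq_right) simp
    then have "inverse (u + v * y) = (u - v * y) / n"
      by (rule inverse_unique)
    also have "\<dots> = u / n + (- v / n) * y"
      by (simp add: diff_divide_distrib)
    also have "\<dots> \<in> M"
      using uv square_in by (intro in_extensionI) (simp_all add: n_def F_closed)
    finally show ?thesis .
  qed
qed

lemma is_subfield_extension: "is_subfield M"
  unfolding is_subfield_iff
proof (intro conjI ballI)
  show "0 \<in> M" "1 \<in> M"
    using extension_superset F_closed(1,2) by auto
  fix x assume "x \<in> M"
  then obtain u v where x: "x = u + v * y" "u \<in> F" "v \<in> F"
    using in_extension_iff by blast
  have "- x = - u + (- v) * y"
    by (simp add: x)
  then show "- x \<in> M"
    using x in_extensionI F_closed(9) by metis
  show "inverse x \<in> M"
    using x inverse_in_extension by simp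
  fix x' assume "x' \<in> M"
  then obtain u' v' where x': "x' = u' + v' * y" "u' \<in> F" "v' \<in> F"
    using in_extension_iff by blast
  have "x + x' = (u + u') + (v + v') * y"
    by (simp add: x x' algebra_simps)
  then show "x + x' \<in> M"
    using x x' in_extensionI F_closed(5) by metis
  show "x * x' \<in> M"
    unfolding x(1) x'(1) extension_mult using x x' square_in by (intro in_extensionI) (simp_all add: F_closed)
qed

definition conjugate :: "'a \<Rightarrow> 'a" where
  "conjugate = (\<lambda>x\<in>M. THE z. \<exists>u\<in>F. \<exists>v\<in>F. x = u + v * y \<and> z = u - v * y)"

lemma conjugate_eq:
  assumes "u \<in> F" "v \<in> F"
  shows "conjugate (u + v * y) = u - v * y"
proof -
  have "(THE z. \<exists>u'\<in>F. \<exists>v'\<in>F. u + v * y = u' + v' * y \<and> z = u' - v' * y) = u - v * y"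
    using assms coordinates_unique[OF assms] by (intro the_equality) blast+
  then show ?thesis
    using in_extensionI[OF assms] by (simp add: conjugate_def)
qed

lemma conjugate_in_Gal: "conjugate \<in> carrier (Gal M F)"
proof -
  have "conjugate x \<in> M \<and> conjugate (conjugate x) = x" if "x \<in> M" for x
  proof -
    obtain u v where x: "x = u + v * y" "u \<in> F" "v \<in> F"
      using \<open>x \<in> M\<close> unfolding in_extension_iff by blast
    have conj_x: "conjugate x = u + (- v) * y"
      using conjugate_eq[OF x(2,3)] by (simp add: x)
    have "- v \<in> F"
      using x(3) by (rule F_closed)
    then show ?thesis
      using conjugate_eq[of u "- v"] in_extensionI[of u "- v"] x unfolding conj_x by simp
  qed
  then have "bij_betw conjugate M M"
    by (intro bij_betw_byWitness[of M conjugate conjugate]) auto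
  moreover have "conjugate (x + x') = conjugate x + conjugate x' \<and> conjugate (x * x') = conjugate x * conjugate x'"
    if "x \<in> M" "x' \<in> M" for x x'
  proof -
    obtain u v u' v' where x: "x = u + v * y" "u \<in> F" "v \<in> F" "x' = u' + v' * y" "u' \<in> F" "v' \<in> F"
      using \<open>x \<in> M\<close> \<open>x' \<in> M\<close> unfolding in_extension_iff by blast
    have sum: "x + x' = (u + u') + (v + v') * y"
      by (simp add: x algebra_simps)
    have prod: "x * x' = (u * u' + v * v' * y\<^sup>2) + (u * v' + v * u') * y"
      unfolding x(1,4) by (rule extension_mult)
    have "conjugate (x + x') = (u + u') - (v + v') * y"
      unfolding sum using x by (intro conjugate_eq F_closed)
    moreover have "conjugate (x * x') = (u * u' + v * v' * y\<^sup>2) - (u * v' + v * u') * y"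
      unfolding prod using x square_in by (intro conjugate_eq) (simp_all add: F_closed)
    moreover have "conjugate x = u - v * y" "conjugate x' = u' - v' * y"
      unfolding x(1,4) using x by (simp_all add: conjugate_eq)
    ultimately show ?thesis
      by (simp only: left_diff_distrib right_diff_distrib) (simp add: algebra_simps power2_eq_square)
  qed
  moreover have "conjugate x = x" if "x \<in> F" for x
    using conjugate_eq[OF that F_closed(1)] by simp
  ultimately show ?thesis
    by (simp add: Gal_def Bij_def conjugate_def)
qed

lemma conjugate_generator: "conjugate y = - y"
  using conjugate_eq[OF F_closed(1,2)] by simp

lemma algebraic_over_base:
  assumes "x \<in> M"
  shows "algebraic_over F x"
proof -
  obtain u v where x: "x = u + v * y" "u \<in> F" "v \<in> F"
    using assms unfolding in_extension_iff by blast
  let ?p = "[:u\<^sup>2 - v\<^sup>2 * y\<^sup>2, - (2 * u), 1:]"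
  have "poly ?p x = 0"
    by (simp add: x algebra_simps power2_eq_square)
  moreover have "u\<^sup>2 - v\<^sup>2 * y\<^sup>2 \<in> F" "- (2 * u) \<in> F"
    using x square_in by (simp_all add: F_closed)
  then have "coeff ?p i \<in> F" for i
    using F_closed(1,2) by (auto simp: coeff_pCons split: nat.split)
  ultimately show ?thesis
    unfolding algebraic_over_def by (metis one_neq_zero pCons_eq_0_iff)
qed

lemma galois_extension: "galois_extension F M"
proof -
  have "x \<in> F" if x: "x \<in> M" "conjugate x = x" for x
  proof -
    obtain u v where uv: "x = u + v * y" "u \<in> F" "v \<in> F"
      using x unfolding in_extension_iff by blast
    have "u + v * y = u + (- v) * y"
      using x(2) conjugate_eq[OF uv(2,3)] uv(1) by simp
    then have "v = - v"
      using coordinates_unique(2)[of u v u "- v"] uv F_closed(9) by blast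
    then show ?thesis
      using uv by (simp add: equal_neg_zero)
  qed
  then have "{x \<in> M. \<forall>f\<in>carrier (Gal M F). f x = x} = F"
    using conjugate_in_Gal extension_superset Gal_fixed[OF is_subfield_extension] by blast
  then show ?thesis
    using subfield_F is_subfield_extension extension_superset(1) algebraic_over_base
    by (simp add: galois_extension_def)
qed

lemma Gal_comm_group: "comm_group (Gal M F)"
proof (rule group.group_comm_groupI[OF group_Gal[OF is_subfield_extension extension_superset(1)]])
  fix f g assume f: "f \<in> carrier (Gal M F)" and g: "g \<in> carrier (Gal M F)"
  note hom = Gal_hom[OF is_subfield_extension]
  have eq: "h (u + v * y) = u + v * h y" if "h \<in> carrier (Gal M F)" "u \<in> F" "v \<in> F" for h u v
    using that hom[OF that(1)] extension_superset subfield_closed(7)[OF is_subfield_extension]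
    by (simp add: subset_iff)
  have root: "h y = y \<or> h y = - y" if "h \<in> carrier (Gal M F)" for h
    using Gal_power[OF is_subfield_extension that extension_superset(2), of 2]
      Gal_fixed[OF is_subfield_extension that square_in]
    by (simp flip: power2_eq_iff)
  have "f (g x) = g (f x)" if "x \<in> M" for x
  proof -
    obtain u v where "x = u + v * y" "u \<in> F" "v \<in> F"
      using \<open>x \<in> M\<close> unfolding in_extension_iff by blast
    then show ?thesis
      using root[OF f] root[OF g] eq[OF f, of u v] eq[OF g, of u v] eq[OF f, of u "- v"] eq[OF g, of u "- v"]
        F_closed(9)[of v] by auto
  qed
  moreover have "f \<in> Bij M" "g \<in> Bij M"
    using f g by (auto simp: Gal_def)
  ultimately show "f \<otimes>\<^bsub>Gal M F\<^esub> g = g \<otimes>\<^bsub>Gal M F\<^esub> f"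
    by (auto simp: Gal_def BijGroup_def compose_def restrict_def fun_eq_iff)
qed

lemma abelian_extension: "abelian_extension F M"
  using galois_extension Gal_comm_group by (simp add: abelian_extension_def)

end

lemma abelian_extension_refl:
  fixes K :: "'a::field set"
  assumes K: "is_subfield K"
  shows "abelian_extension K K"
proof -
  have Gal_trivial: "f = (\<lambda>x\<in>K. x)" if "f \<in> carrier (Gal K K)" for f
    using that by (auto simp: Gal_def Bij_def extensional_def restrict_def)
  have "algebraic_over K x" if "x \<in> K" for x
    using that K unfolding algebraic_over_def is_subfield_iff
    by (intro exI[of _ "[:- x, 1:]"]) (auto simp: coeff_pCons split: nat.split)
  then have "galois_extension K K"
    using K unfolding galois_extension_def by (auto dest: Gal_trivial)
  moreover have "comm_group (Gal K K)"
    by (rule group.group_comm_groupI[OF group_Gal[OF K order_refl]]) (use Gal_trivial in metis)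
  ultimately show ?thesis
    by (simp add: abelian_extension_def)
qed

lemma abelian_extension_subset_max: "abelian_extension K M \<Longrightarrow> M \<subseteq> max_abelian_extension K"
  unfolding max_abelian_extension_def by blast

lemma is_subfield_max_abelian_extension: "is_subfield (max_abelian_extension K)"
  unfolding is_subfield_iff max_abelian_extension_def by blast

section \<open>The Galois action on points\<close>

fun map_point :: "('a \<Rightarrow> 'b) \<Rightarrow> 'a ec_point \<Rightarrow> 'b ec_point" where
  "map_point g Infinity = Infinity"
| "map_point g (Affine x y) = Affine (g x) (g y)"

definition weierstrass_over :: "'a set \<Rightarrow> 'a weierstrass \<Rightarrow> bool" where
  "weierstrass_over K E \<longleftrightarrow> {wa1 E, wa2 E, wa3 E, wa4 E, wa6 E} \<subseteq> K"

lemma Gal_ec_slope: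
  fixes M :: "'a::field_char_0 set"
  assumes M: "is_subfield M" and KM: "K \<subseteq> M" and E: "weierstrass_over K E" and g: "g \<in> carrier (Gal M K)"
    and in_M: "x1 \<in> M" "y1 \<in> M" "x2 \<in> M" "y2 \<in> M"
  shows "ec_slope E x1 y1 x2 y2 \<in> M"
    and "g (ec_slope E x1 y1 x2 y2) = ec_slope E (g x1) (g y1) (g x2) (g y2)"
proof -
  have coeffs: "wa1 E \<in> K" "wa2 E \<in> K" "wa3 E \<in> K" "wa4 E \<in> K"
    using E by (auto simp: weierstrass_over_def)
  then have "wa1 E \<in> M" "wa2 E \<in> M" "wa3 E \<in> M" "wa4 E \<in> M"
    using KM by auto
  then show "ec_slope E x1 y1 x2 y2 \<in> M"
    and "g (ec_slope E x1 y1 x2 y2) = ec_slope E (g x1) (g y1) (g x2) (g y2)"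
    using in_M coeffs
    by (simp_all add: ec_slope_def Gal_hom[OF M g] Gal_eq_iff[OF M g] subfield_closed[OF M])
qed

lemma map_point_ec_add:
  fixes M :: "'a::field_char_0 set"
  assumes M: "is_subfield M" and KM: "K \<subseteq> M" and E: "weierstrass_over K E"
    and g: "g \<in> carrier (Gal M K)" and P: "P \<in> ec_points E M" and Q: "Q \<in> ec_points E M"
  shows "map_point g (ec_add E P Q) = ec_add E (map_point g P) (map_point g Q)"
proof (cases P; cases Q)
  fix x1 y1 x2 y2 assume PQ: "P = Affine x1 y1" "Q = Affine x2 y2"
  note hom = Gal_hom[OF M g] and closed = subfield_closed[OF M]
  have coeffs: "wa1 E \<in> K" "wa2 E \<in> K" "wa3 E \<in> K"
    using E by (auto simp: weierstrass_over_def)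
  have in_M: "x1 \<in> M" "y1 \<in> M" "x2 \<in> M" "y2 \<in> M" "wa1 E \<in> M" "wa2 E \<in> M" "wa3 E \<in> M"
    using P Q KM coeffs by (auto simp: PQ ec_points_def)
  have "g (y1 + y2 + wa1 E * x2 + wa3 E) = g y1 + g y2 + wa1 E * g x2 + wa3 E"
    using in_M coeffs by (simp add: hom closed)
  moreover have "y1 + y2 + wa1 E * x2 + wa3 E \<in> M"
    using in_M by (intro closed)
  ultimately have opposite: "x1 = x2 \<and> y1 + y2 + wa1 E * x2 + wa3 E = 0
      \<longleftrightarrow> g x1 = g x2 \<and> g y1 + g y2 + wa1 E * g x2 + wa3 E = 0"
    using in_M Gal_0[OF M g] Gal_eq_iff[OF M g] closed(1) by metis
  show ?thesis
  proof (cases "x1 = x2 \<and> y1 + y2 + wa1 E * x2 + wa3 E = 0")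
    case True
    then show ?thesis
      using opposite by (simp add: PQ)
  next
    case False
    define l x3 where "l = ec_slope E x1 y1 x2 y2" and "x3 = l\<^sup>2 + wa1 E * l - wa2 E - x1 - x2"
    note slope = Gal_ec_slope[OF M KM E g in_M(1-4), folded l_def]
    have "x3 \<in> M" and g_x3: "g x3 = (g l)\<^sup>2 + wa1 E * g l - wa2 E - g x1 - g x2"
      using in_M coeffs slope(1) by (simp_all add: x3_def hom closed)
    have "ec_add E (map_point g P) (map_point g Q)
        = Affine (g x3) (- (g l + wa1 E) * g x3 - (g y1 - g l * g x1) - wa3 E)"
      unfolding PQ map_point.simps
      by (rule ec_add_Affine[OF _ slope(2) g_x3]) (use False opposite in simp)
    also have "\<dots> = map_point g (Affine x3 (- (l + wa1 E) * x3 - (y1 - l * x1) - wa3 E))"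
      using slope(1) \<open>x3 \<in> M\<close> in_M coeffs by (simp add: hom closed)
    also have "Affine x3 (- (l + wa1 E) * x3 - (y1 - l * x1) - wa3 E) = ec_add E P Q"
      unfolding PQ by (rule ec_add_Affine[symmetric, OF False l_def x3_def])
    finally show ?thesis by (rule sym)
  qed
qed simp_all

lemma map_point_hom:
  fixes M :: "'a::field_char_0 set"
  assumes "is_subfield M" "K \<subseteq> M" "weierstrass_over K E" and g: "g \<in> carrier (Gal M K)"
  shows "map_point g \<in> hom (mordell_weil_group E M) (mordell_weil_group E M)"
proof (rule homI; simp only: mordell_weil_group_simps)
  show "map_point g (ec_add E P Q) = ec_add E (map_point g P) (map_point g Q)"
    if "P \<in> ec_points E M" "Q \<in> ec_points E M" for P Q
    by (rule map_point_ec_add[OF assms that])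
  fix P assume P: "P \<in> ec_points E M"
  show "map_point g P \<in> ec_points E M"
  proof (cases P)
    case (Affine x y)
    note hom = Gal_hom[OF assms(1) g]
    have coeffs: "wa1 E \<in> K" "wa2 E \<in> K" "wa3 E \<in> K" "wa4 E \<in> K" "wa6 E \<in> K"
      using assms(3) by (auto simp: weierstrass_over_def)
    have in_M: "x \<in> M" "y \<in> M" "wa1 E \<in> M" "wa2 E \<in> M" "wa3 E \<in> M" "wa4 E \<in> M" "wa6 E \<in> M"
      using P coeffs assms(2) by (auto simp: Affine ec_points_def)
    have "g (y\<^sup>2 + wa1 E * x * y + wa3 E * y) = g (x ^ 3 + wa2 E * x\<^sup>2 + wa4 E * x + wa6 E)"
      using P by (simp add: Affine ec_points_def)
    then show ?thesis
      using in_M coeffs by (simp add: Affine ec_points_def hom subfield_closed[OF assms(1)])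
  qed simp
qed

lemma subgroup_ec_points:
  assumes M: "group (mordell_weil_group E M)" and L: "group (mordell_weil_group E L)" and "M \<subseteq> L"
  shows "subgroup (ec_points E M) (mordell_weil_group E L)"
proof (rule group.group_incl_imp_subgroup[OF L])
  show "ec_points E M \<subseteq> carrier (mordell_weil_group E L)"
    using \<open>M \<subseteq> L\<close> by (auto simp: ec_points_def)
  show "group ((mordell_weil_group E L)\<lparr>carrier := ec_points E M\<rparr>)"
    using M by (simp add: mordell_weil_group_def)
qed

lemma map_point_fixed: "(\<And>x. x \<in> F \<Longrightarrow> g x = x) \<Longrightarrow> P \<in> ec_points E F \<Longrightarrow> map_point g P = P"
  by (cases P) (simp_all add: ec_points_def)

lemma int_pow_mordell_weil_group:
  assumes "group (mordell_weil_group E M)" "group (mordell_weil_group E L)" "M \<subseteq> L" "P \<in> ec_points E M"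
  shows "P [^]\<^bsub>mordell_weil_group E L\<^esub> (k :: int) = P [^]\<^bsub>mordell_weil_group E M\<^esub> k"
  using group.int_pow_consistent[OF assms(2) subgroup_ec_points[OF assms(1-3)] assms(4)]
  by (simp add: mordell_weil_group_def)

lemma (in nonsingular_cubic) int_pow_not_over_base:
  assumes "quadratic_generator F y" and abc: "a \<in> F" "b \<in> F" "c \<in> F" and P: "x \<in> F" "y\<^sup>2 = f x"
    and k: "Affine x y [^]\<^bsub>point_group (quadratic_extension F y)\<^esub> (2 * k) \<noteq> Infinity"
  shows "Affine x y [^]\<^bsub>point_group (quadratic_extension F y)\<^esub> (k :: int) \<notin> points F"
proof
  interpret quadratic_generator F y by fact
  define G where "G = point_group M"
  have abc_M: "a \<in> M" "b \<in> M" "c \<in> M"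
    using abc extension_superset by auto
  interpret G: comm_group G
    unfolding G_def by (rule comm_group_cubic_curve[OF is_subfield_extension abc_M])
  have "weierstrass_over F (cubic_curve a b c)"
    using abc F_closed(1) by (simp add: weierstrass_over_def)
  then interpret \<tau>: group_hom G G "map_point conjugate"
    unfolding G_def using G.is_group
    by (intro group_hom.intro group_hom_axioms.intro map_point_hom[OF is_subfield_extension extension_superset(1) _ conjugate_in_Gal])
      (simp_all add: G_def)
  note fixes_F = Gal_fixed[OF is_subfield_extension conjugate_in_Gal]
  have P_in: "Affine x y \<in> carrier G"
    using P extension_superset by (auto simp: G_def ec_points_def cubic_def)
  then have "map_point conjugate (Affine x y) = inv\<^bsub>G\<^esub> Affine x y"
    using inv_cubic_curve[OF is_subfield_extension abc_M] fixes_F[OF P(1)]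
    by (simp add: G_def conjugate_generator)
  then have "map_point conjugate (Affine x y [^]\<^bsub>G\<^esub> k) = inv\<^bsub>G\<^esub> (Affine x y [^]\<^bsub>G\<^esub> k)"
    using \<tau>.hom_int_pow[OF P_in, of k] G.int_pow_inv[OF P_in, of k] by simp
  moreover assume "Affine x y [^]\<^bsub>point_group M\<^esub> k \<in> points F"
  then have "map_point conjugate (Affine x y [^]\<^bsub>G\<^esub> k) = Affine x y [^]\<^bsub>G\<^esub> k"
    unfolding G_def using map_point_fixed[of F conjugate] fixes_F by blast
  ultimately have "inv\<^bsub>G\<^esub> (Affine x y [^]\<^bsub>G\<^esub> k) = Affine x y [^]\<^bsub>G\<^esub> k"
    by simp
  then have "Affine x y [^]\<^bsub>G\<^esub> (2 * k) = \<one>\<^bsub>G\<^esub>"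
    using G.r_inv[OF G.int_pow_closed[OF P_in, of k]] G.int_pow_mult[OF P_in, of k k] by simp
  then show False
    using k by (simp add: G_def)
qed

section \<open>Traces of matrices that square to zero modulo a prime\<close>

lemma coeff_char_poly_trace:
  fixes A :: "'a::{idom, ring_char_0} mat"
  assumes "A \<in> carrier_mat (Suc n) (Suc n)"
  shows "coeff (char_poly A) n = - (\<Sum>i<Suc n. A $$ (i, i))"
  using assms
proof (induction n arbitrary: A)
  case 0
  then show ?case
    by (subst char_poly_upper_triangular[of _ 1]) (auto simp: upper_triangular_def diag_mat_def)
next
  case (Suc n)
  let ?N = "Suc (Suc n)"
  define t where "t = (\<Sum>i<?N. A $$ (i, i))"
  have minor: "coeff (char_poly (mat_delete A i i)) n = A $$ (i, i) - t" if i: "i < ?N" for i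
  proof -
    have "mat_delete A i i \<in> carrier_mat (Suc n) (Suc n)"
      using mat_delete_carrier[OF Suc.prems] by simp
    then have "coeff (char_poly (mat_delete A i i)) n = - (\<Sum>j<Suc n. mat_delete A i i $$ (j, j))"
      by (rule Suc.IH)
    also have "(\<Sum>j<Suc n. mat_delete A i i $$ (j, j)) = (\<Sum>j<Suc n. A $$ (insert_index i j, insert_index i j))"
      using i by (intro sum.cong mat_delete_index[OF Suc.prems, symmetric]) auto
    also have "\<dots> = (\<Sum>j\<in>insert_index i ` {0..<Suc n}. A $$ (j, j))"
      using insert_index_inj_on[of i] by (subst sum.reindex) (auto simp: lessThan_atLeast0)
    also have "insert_index i ` {0..<Suc n} = {..<?N} - {i}"
      using insert_index_image[of i "Suc n"] i by (simp add: lessThan_atLeast0)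
    also have "(\<Sum>j\<in>{..<?N} - {i}. A $$ (j, j)) = t - A $$ (i, i)"
      using i by (simp only: t_def sum_diff1 finite_lessThan lessThan_iff if_True)
    finally show ?thesis by simp
  qed
  have "of_nat (Suc n) * coeff (char_poly A) (Suc n) = coeff (pderiv (char_poly A)) n"
    by (simp add: coeff_pderiv)
  also have "\<dots> = (\<Sum>i<?N. A $$ (i, i) - t)"
    unfolding pderiv_char_poly[OF Suc.prems] coeff_sum using minor by (intro sum.cong) auto
  also have "\<dots> = of_nat (Suc n) * (- t)"
    by (simp add: sum_subtractf t_def algebra_simps del: sum.lessThan_Suc)
  finally show ?case
    unfolding t_def mult_cancel_left by (simp del: of_nat_Suc)
qed

lemma dvd_prod_diff:
  fixes f g :: "'i \<Rightarrow> 'a::comm_ring_1"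
  assumes "\<And>i. i \<in> I \<Longrightarrow> c dvd f i - g i"
  shows "c dvd prod f I - prod g I"
  using assms
proof (induction I rule: infinite_finite_induct)
  case (insert i I)
  have "prod f (insert i I) - prod g (insert i I) = (f i - g i) * prod f I + g i * (prod f I - prod g I)"
    using insert.hyps by (simp add: algebra_simps)
  then show ?case
    using insert by (simp add: dvd_add)
qed auto

lemma dvd_det_diff:
  fixes A B :: "'a::comm_ring_1 mat"
  assumes A: "A \<in> carrier_mat n n" and B: "B \<in> carrier_mat n n"
    and dvd: "\<And>i j. i < n \<Longrightarrow> j < n \<Longrightarrow> c dvd A $$ (i, j) - B $$ (i, j)"
  shows "c dvd det A - det B"
  unfolding det_def'[OF A] det_def'[OF B] sum_subtractf[symmetric] right_diff_distrib[symmetric]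
proof (intro dvd_sum dvd_mult dvd_prod_diff)
  fix p i assume "p \<in> {p. p permutes {0..<n}}" "i \<in> {0..<n}"
  then show "c dvd A $$ (i, p i) - B $$ (i, p i)"
    by (intro dvd) (auto simp: permutes_in_image)
qed

lemma prime_dvd_low_coeffs:
  fixes p r :: "int poly" and q :: int
  assumes q: "prime q" and lead: "\<not> q dvd coeff r n"
    and dvd: "\<And>m. m < d + n \<Longrightarrow> q dvd coeff (p * r) m" and "k < d"
  shows "q dvd coeff p k"
proof (rule ccontr)
  assume nk: "\<not> q dvd coeff p k"
  obtain i where i: "\<not> q dvd coeff p i" "\<And>m. m < i \<Longrightarrow> q dvd coeff p m"
    using exists_least_iff[of "\<lambda>i. \<not> q dvd coeff p i"] nk by blast
  obtain j where j: "\<not> q dvd coeff r j" "\<And>m. m < j \<Longrightarrow> q dvd coeff r m"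
    using exists_least_iff[of "\<lambda>j. \<not> q dvd coeff r j"] lead by blast
  have "i \<le> k" "j \<le> n"
    using i(2) j(2) nk lead not_less by blast+
  have "q dvd (\<Sum>m\<in>{..i + j} - {i}. coeff p m * coeff r (i + j - m))"
  proof (rule dvd_sum)
    fix m assume "m \<in> {..i + j} - {i}"
    then have "m < i \<or> i + j - m < j" by auto
    then show "q dvd coeff p m * coeff r (i + j - m)"
      using i(2) j(2) by auto
  qed
  moreover have "q dvd coeff (p * r) (i + j)"
    using \<open>i \<le> k\<close> \<open>j \<le> n\<close> \<open>k < d\<close> by (intro dvd) simp
  moreover have "coeff (p * r) (i + j)
      = coeff p i * coeff r j + (\<Sum>m\<in>{..i + j} - {i}. coeff p m * coeff r (i + j - m))"
    unfolding coeff_mult by (subst sum.remove[of _ i]) auto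
  ultimately have "q dvd coeff p i * coeff r j"
    by (simp add: dvd_add_left_iff)
  then show False
    using i(1) j(1) q by (simp add: prime_dvd_mult_iff)
qed

lemma char_poly_mult_uminus_entry:
  fixes A :: "'a::comm_ring_1 mat"
  assumes A: "A \<in> carrier_mat n n" and ij: "i < n" "j < n"
  shows "(char_poly_matrix A * char_poly_matrix (- A)) $$ (i, j)
    = [:- (A * A) $$ (i, j), 0, of_bool (i = j):]"
proof -
  have "(char_poly_matrix A * char_poly_matrix (- A)) $$ (i, j)
      = (\<Sum>k = 0..<n. [:- A $$ (i, k), of_bool (i = k):] * [:A $$ (k, j), of_bool (k = j):])"
    using A ij by (auto simp: char_poly_matrix_def scalar_prod_def intro!: sum.cong)
  also have "\<dots> = (\<Sum>k = 0..<n. [:- (A $$ (i, k) * A $$ (k, j)),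
      of_bool (i = k) * A $$ (k, j) - A $$ (i, k) * of_bool (k = j), of_bool (i = k) * of_bool (k = j):])"
    by (intro sum.cong) (simp_all add: algebra_simps)
  also have "\<dots> = [:- (\<Sum>k = 0..<n. A $$ (i, k) * A $$ (k, j)),
      (\<Sum>k = 0..<n. of_bool (i = k) * A $$ (k, j) - A $$ (i, k) * of_bool (k = j)),
      (\<Sum>k = 0..<n. of_bool (i = k) * of_bool (k = j)):]"
    by (rule poly_eqI) (simp add: coeff_sum coeff_pCons sum_negf split: nat.split)
  also have "\<dots> = [:- (A * A) $$ (i, j), 0, of_bool (i = j):]"
    using A ij by (simp add: scalar_prod_def sum_subtractf of_bool_def if_distrib[of "\<lambda>x. x * _"]
        if_distrib[of "\<lambda>x. _ * x"] sum.delta sum.delta' cong: if_cong)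
  finally show ?thesis .
qed

lemma prime_dvd_trace_of_square:
  fixes A :: "int mat"
  assumes q: "prime q" and A: "A \<in> carrier_mat n n"
    and sq: "\<And>i j. i < n \<Longrightarrow> j < n \<Longrightarrow> q dvd (A * A) $$ (i, j)"
  shows "q dvd (\<Sum>i<n. A $$ (i, i))"
proof (cases n)
  case (Suc m)
  let ?p = "char_poly A" and ?r = "char_poly (- A)"
  have uminus_A: "- A \<in> carrier_mat n n"
    using A by simp
  have "[:q:] dvd det (char_poly_matrix A * char_poly_matrix (- A)) - det ([:0, 0, 1:] \<cdot>\<^sub>m 1\<^sub>m n)"
  proof (rule dvd_det_diff)
    fix i j assume ij: "i < n" "j < n"
    then have "(char_poly_matrix A * char_poly_matrix (- A)) $$ (i, j) - ([:0, 0, 1:] \<cdot>\<^sub>m 1\<^sub>m n) $$ (i, j)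
        = [:- (A * A) $$ (i, j):]"
      unfolding char_poly_mult_uminus_entry[OF A ij] by simp
    then show "[:q:] dvd (char_poly_matrix A * char_poly_matrix (- A)) $$ (i, j) - ([:0, 0, 1:] \<cdot>\<^sub>m 1\<^sub>m n) $$ (i, j)"
      using sq[OF ij] by (simp add: const_poly_dvd_const_poly_iff)
  qed (use char_poly_matrix_closed[OF A] char_poly_matrix_closed[OF uminus_A] in auto)
  also have "det (char_poly_matrix A * char_poly_matrix (- A)) = ?p * ?r"
    unfolding char_poly_def using A uminus_A by (intro det_mult[of _ n]) auto
  also have "det ([:0, 0, 1:] \<cdot>\<^sub>m 1\<^sub>m n) = ([:0, 0, 1:] ^ n :: int poly)"
    by simp
  also have "[:0, 0, 1:] ^ n = (monom 1 (2 * n) :: int poly)"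
    by (simp add: monom_altdef power_mult power2_eq_square)
  finally have dvd: "\<forall>k. q dvd coeff (?p * ?r - monom 1 (2 * n)) k"
    unfolding const_poly_dvd_iff .
  have low: "q dvd coeff (?p * ?r) k" if "k < n + n" for k
    using dvd[rule_format, of k] that by simp
  have lead: "\<not> q dvd coeff ?r n"
    using degree_monic_char_poly[OF uminus_A] q by auto
  have "q dvd coeff ?p m"
    by (rule prime_dvd_low_coeffs[where d = n and k = m, OF q lead low]) (simp_all add: \<open>n = Suc m\<close>)
  then show ?thesis
    using coeff_char_poly_trace[of A m] A Suc by (simp del: sum.lessThan_Suc)
qed simp

lemma dvd_det_mult_vec:
  fixes A :: "'a::comm_ring_1 mat" and v :: "'a vec"
  assumes A: "A \<in> carrier_mat n n" and v: "v \<in> carrier_vec n"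
    and dvd: "\<And>i. i < n \<Longrightarrow> c dvd (A *\<^sub>v v) $ i" and k: "k < n"
  shows "c dvd det A * v $ k"
proof -
  note adj = adj_mat[OF A]
  define u where "u = A *\<^sub>v v"
  have u: "u \<in> carrier_vec n"
    unfolding u_def by (rule mult_mat_vec_carrier[OF A v])
  have "det A * v $ k = ((det A \<cdot>\<^sub>m 1\<^sub>m n) *\<^sub>v v) $ k"
    using v k by simp
  also have "\<dots> = (adj_mat A *\<^sub>v u) $ k"
    unfolding adj(3)[symmetric] u_def using assoc_mult_mat_vec[OF adj(1) A v] by simp
  also have "\<dots> = (\<Sum>i = 0..<n. adj_mat A $$ (k, i) * u $ i)"
    using adj(1) u k by (simp add: scalar_prod_def)
  also have "c dvd \<dots>"
    using dvd by (intro dvd_sum dvd_mult) (simp add: u_def)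
  finally show ?thesis .
qed

section \<open>Orders in number fields\<close>

lemma common_multiplier:
  fixes A S :: "'a::comm_semiring_1 set"
  assumes "finite S" and multiplier: "\<And>z. z \<in> S \<Longrightarrow> \<exists>n>0. of_nat n * z \<in> A"
    and closed: "\<And>n z. z \<in> A \<Longrightarrow> of_nat n * z \<in> A"
  shows "\<exists>n>0. \<forall>z\<in>S. of_nat n * z \<in> A"
  using assms(1,2)
proof (induction S rule: finite_induct)
  case (insert z S)
  then obtain n m where n: "n > 0" "\<And>w. w \<in> S \<Longrightarrow> of_nat n * w \<in> A" and m: "m > 0" "of_nat m * z \<in> A"
    by (metis insertCI)
  have "of_nat (n * m) * w \<in> A" if "w \<in> insert z S" for w
  proof (cases "w = z")
    case True
    then show ?thesis
      using closed[OF m(2), of n] by (simp add: mult.assoc)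
  next
    case False
    then show ?thesis
      using closed[OF n(2), of w m] that by (simp add: ac_simps)
  qed
  then show ?case
    using n(1) m(1) by (intro exI[of _ "n * m"]) simp
qed auto

locale unital_subring =
  fixes R :: "'a::field_char_0 set"
  assumes one_closed: "1 \<in> R" and add_closed: "x \<in> R \<Longrightarrow> y \<in> R \<Longrightarrow> x + y \<in> R"
    and mult_closed: "x \<in> R \<Longrightarrow> y \<in> R \<Longrightarrow> x * y \<in> R" and uminus_closed: "x \<in> R \<Longrightarrow> - x \<in> R"
begin

lemma zero_closed: "0 \<in> R"
  using add_closed[OF one_closed uminus_closed[OF one_closed]] by simp

lemma diff_closed: "x \<in> R \<Longrightarrow> y \<in> R \<Longrightarrow> x - y \<in> R"
  using add_closed[OF _ uminus_closed] by fastforce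

lemma of_nat_closed: "of_nat n \<in> R"
  by (induction n) (auto intro: zero_closed one_closed add_closed)

lemma of_int_closed: "of_int k \<in> R"
  by (cases k rule: int_diff_cases) (simp add: diff_closed of_nat_closed)

lemma sum_closed: "(\<And>i. i \<in> I \<Longrightarrow> g i \<in> R) \<Longrightarrow> sum g I \<in> R"
  by (induction I rule: infinite_finite_induct) (simp_all add: zero_closed add_closed)

lemma numeral_closed: "numeral k \<in> R"
  using of_nat_closed[of "numeral k"] by simp

lemma power_closed: "x \<in> R \<Longrightarrow> x ^ n \<in> R"
  by (induction n) (auto intro: one_closed mult_closed)

lemmas closed = zero_closed one_closed add_closed mult_closed uminus_closed diff_closed of_nat_closed
  numeral_closed power_closed

end

locale number_field_order = unital_subring R for R :: "'a::field_char_0 set" +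
  fixes K :: "'a set"
  assumes subfield_K: "is_subfield K" and subset_K: "R \<subseteq> K"
    and denominator: "z \<in> K \<Longrightarrow> \<exists>n>0. of_nat n * z \<in> R"
    and rational_integral: "of_rat r \<in> R \<Longrightarrow> r \<in> \<int>"
begin

lemma common_denominator:
  assumes "finite S" "S \<subseteq> K"
  shows "\<exists>n>0. \<forall>z\<in>S. of_nat n * z \<in> R"
  using assms(1)
proof (rule common_multiplier)
  show "\<exists>n>0. of_nat n * z \<in> R" if "z \<in> S" for z
    using assms(2) that by (blast intro: denominator)
qed (intro closed)

definition reduced_mod :: "nat \<Rightarrow> bool" where
  "reduced_mod q \<longleftrightarrow> (\<forall>z\<in>R. z\<^sup>2 / of_nat q \<in> R \<longrightarrow> z / of_nat q \<in> R)"

lemma dvd_if_quotient_in: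
  assumes "q > 0" "of_nat n / of_nat q \<in> R"
  shows "q dvd n"
proof -
  have "of_rat (of_nat n / of_nat q) \<in> R"
    using assms(2) by (simp add: of_rat_divide)
  then have "(of_nat n / of_nat q :: rat) \<in> \<int>"
    by (rule rational_integral)
  then obtain k where "of_nat n / of_nat q = (of_int k :: rat)"
    by (elim Ints_cases)
  then have "(of_int (int n) :: rat) = of_int (k * int q)"
    using assms(1) by (simp add: field_simps)
  then have "int n = k * int q"
    unfolding of_int_eq_iff .
  then show ?thesis
    by (metis dvd_triv_right int_dvd_int_iff)
qed

text \<open>An element of valuation one at a prime modulo which the order is reduced is not a square.\<close>

lemma prime_dvd_of_square_eq:
  assumes q: "prime q" and reduced: "reduced_mod q" and y: "y \<in> K"
    and h: "h \<in> R" and eq: "y\<^sup>2 = of_nat q * (of_nat n + of_nat q * h)"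
  shows "q dvd n"
proof -
  have q0: "q > 0" "(of_nat q :: 'a) \<noteq> 0"
    using q prime_gt_0_nat by auto
  obtain m where m: "m > 0" "of_nat m * y \<in> R" and minimal: "\<And>j. j < m \<Longrightarrow> \<not> (j > 0 \<and> of_nat j * y \<in> R)"
    using exists_least_iff[of "\<lambda>m. m > 0 \<and> of_nat m * y \<in> R"] denominator[OF y] by blast
  let ?z = "of_nat m * y"
  have square: "?z\<^sup>2 / of_nat q = of_nat (m\<^sup>2) * (of_nat n + of_nat q * h)"
    using q0 by (simp add: power_mult_distrib eq)
  moreover have "of_nat (m\<^sup>2) * (of_nat n + of_nat q * h) \<in> R"
    by (intro closed h)
  ultimately have z: "?z / of_nat q \<in> R"
    using reduced m(2) by (simp add: reduced_mod_def)
  have "\<not> q dvd m"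
  proof
    assume "q dvd m"
    then obtain j where "m = q * j" ..
    then show False
      using minimal[of j] m(1) z q0 prime_gt_1_nat[OF q] by auto
  qed
  have "of_nat (m\<^sup>2 * n) / of_nat q = (?z / of_nat q)\<^sup>2 - of_nat (m\<^sup>2) * h"
    using square q0 by (simp add: field_simps power2_eq_square)
  also have "\<dots> \<in> R"
    by (intro closed z h)
  finally have "q dvd m\<^sup>2 * n"
    by (rule dvd_if_quotient_in[OF q0(1)])
  then show ?thesis
    using q \<open>\<not> q dvd m\<close> by (auto simp: prime_dvd_mult_iff dest: prime_dvd_power)
qed

end

interpretation rat: vector_space "\<lambda>(q::rat) (x::'a::field_char_0). of_rat q * x"
  by (rule vector_space_of_rat)

declare rat.scale_scale [simp del]

lemma (in quadratic_generator) number_field_extension: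
  assumes "number_field F"
  shows "number_field M"
proof -
  interpret pair: vector_space_pair "\<lambda>(q::rat) (x::'a). of_rat q * x" "\<lambda>(q::rat) (x::'a). of_rat q * x"
    by unfold_locales
  obtain B where B: "finite B" "F = rat.span B"
    using assms by (auto simp: number_field_def)
  have "Vector_Spaces.linear (\<lambda>(q::rat) (x::'a). of_rat q * x) (\<lambda>q x. of_rat q * x) (\<lambda>b. b * y)"
    by unfold_locales (simp_all add: distrib_right mult.assoc)
  then have "rat.span (B \<union> (\<lambda>b. b * y) ` B) = {u + w | u w. u \<in> F \<and> w \<in> (\<lambda>b. b * y) ` F}"
    by (simp only: rat.span_Un pair.linear_span_image B(2))
  also have "\<dots> = M"
    unfolding quadratic_extension_def by blast
  finally show ?thesis
    using is_subfield_extension B(1) unfolding number_field_def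
    by (intro conjI exI[of _ "B \<union> (\<lambda>b. b * y) ` B"]) simp_all
qed

lemma number_field_finite_basis:
  assumes "number_field K"
  obtains B where "finite B" "rat.independent B" "rat.span B = K"
proof -
  obtain S where S: "finite S" "K = rat.span S"
    using assms by (auto simp: number_field_def)
  obtain B where B: "B \<subseteq> S" "rat.independent B" "S \<subseteq> rat.span B"
    using rat.maximal_independent_subset by metis
  have "rat.span B = K"
    using B S(2) rat.span_mono[OF B(1)] rat.span_minimal[OF B(3) rat.subspace_span] by blast
  then show ?thesis
    using that B finite_subset S(1) by blast
qed

lemma rat_common_denominator:
  assumes "finite (S :: rat set)"
  shows "\<exists>n>0. \<forall>r\<in>S. of_nat n * r \<in> \<int>"
  using assms
proof (rule common_multiplier)
  show "\<exists>n>0. of_nat n * r \<in> \<int>" for r :: rat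
  proof (cases r rule: Rat_cases)
    case (Fract a b)
    then have "of_nat (nat b) * r = of_int a"
      by (simp add: Fract_of_int_quotient)
    then show ?thesis
      using Fract(2) by (intro exI[of _ "nat b"]) simp
  qed
qed simp

locale integral_basis =
  fixes K :: "'a::field_char_0 set" and d :: nat and b :: "nat \<Rightarrow> 'a" and coord :: "nat \<Rightarrow> 'a \<Rightarrow> rat"
  assumes subfield_K: "is_subfield K" and basis_in_K: "i < d \<Longrightarrow> b i \<in> K"
    and coord_add: "coord i (x + y) = coord i x + coord i y"
    and coord_scale: "coord i (of_rat r * x) = r * coord i x"
    and coord_basis: "i < d \<Longrightarrow> j < d \<Longrightarrow> coord i (b j) = of_bool (i = j)"
    and basis_expansion: "z \<in> K \<Longrightarrow> z = (\<Sum>j<d. of_rat (coord j z) * b j)"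
    and structure_constants: "i < d \<Longrightarrow> j < d \<Longrightarrow> k < d \<Longrightarrow> coord k (b i * b j) \<in> \<int>"
begin

lemmas K_closed = subfield_closed[OF subfield_K]

lemma coord_0: "coord i 0 = 0"
  using coord_scale[of i 0 0] by simp

lemma coord_sum: "coord i (sum g J) = (\<Sum>j\<in>J. coord i (g j))"
  by (induction J rule: infinite_finite_induct) (simp_all add: coord_0 coord_add)

lemma coord_uminus: "coord i (- x) = - coord i x"
  using coord_scale[of i "-1" x] by simp

lemma coord_divide_of_nat: "coord i (x / of_nat n) = coord i x / of_nat n"
  using coord_scale[of i "1 / of_nat n" x] by (simp add: of_rat_divide)

lemma coord_mult_expansion:
  assumes "w \<in> K"
  shows "coord i (z * w) = (\<Sum>j<d. coord i (z * b j) * coord j w)"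
proof -
  have "coord i (z * w) = coord i (\<Sum>j<d. of_rat (coord j w) * (z * b j))"
    by (subst basis_expansion[OF assms]) (simp add: sum_distrib_left mult.left_commute)
  then show ?thesis
    by (simp only: coord_sum coord_scale) (simp only: mult.commute)
qed

lemma dimension_pos: "d > 0"
proof (rule ccontr)
  assume "\<not> d > 0"
  then show False
    using basis_expansion[of 1] K_closed(2) by simp
qed

definition multiplier_ring :: "'a set" where
  "multiplier_ring = {z \<in> K. \<forall>i<d. \<forall>j<d. coord i (z * b j) \<in> \<int>}"

lemma basis_in_multiplier_ring: "j < d \<Longrightarrow> b j \<in> multiplier_ring"
  by (simp add: multiplier_ring_def basis_in_K structure_constants)

lemma coord_mult_basis_in_Ints:
  "z \<in> multiplier_ring \<Longrightarrow> i < d \<Longrightarrow> j < d \<Longrightarrow> coord i (z * b j) \<in> \<int>"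
  by (simp add: multiplier_ring_def)

lemma multiplier_ring_mult:
  assumes x: "x \<in> multiplier_ring" and y: "y \<in> multiplier_ring"
  shows "x * y \<in> multiplier_ring"
proof -
  have xy: "x \<in> K" "y \<in> K"
    using x y by (auto simp: multiplier_ring_def)
  have "coord i (x * y * b j) \<in> \<int>" if "i < d" "j < d" for i j
  proof -
    have "coord i (x * y * b j) = (\<Sum>k<d. coord i (x * b k) * coord k (y * b j))"
      using xy basis_in_K that K_closed(7) by (simp add: mult.assoc coord_mult_expansion)
    also have "\<dots> \<in> \<int>"
      using x y that by (intro Ints_sum Ints_mult coord_mult_basis_in_Ints) auto
    finally show ?thesis .
  qed
  then show ?thesis
    using xy K_closed(7) by (simp add: multiplier_ring_def)
qed

lemma denominator_multiplier_ring:
  assumes z: "z \<in> K"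
  shows "\<exists>n>0. of_nat n * z \<in> multiplier_ring"
proof -
  have "finite ((\<lambda>(i, j). coord i (z * b j)) ` ({..<d} \<times> {..<d}))"
    by simp
  from rat_common_denominator[OF this]
  obtain n :: nat where "n > 0" "\<And>i j. i < d \<Longrightarrow> j < d \<Longrightarrow> of_nat n * coord i (z * b j) \<in> \<int>"
    by auto
  moreover have "coord i (of_nat n * z * b j) = of_nat n * coord i (z * b j)" for i j
    using coord_scale[of i "of_nat n" "z * b j"] by (simp add: mult.assoc)
  ultimately show ?thesis
    using z by (intro exI[of _ n]) (simp add: multiplier_ring_def K_closed)
qed

sublocale number_field_order multiplier_ring K
proof (intro number_field_order.intro unital_subring.intro number_field_order_axioms.intro)
  show "1 \<in> multiplier_ring"
    by (simp add: multiplier_ring_def K_closed coord_basis)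
  show "x + y \<in> multiplier_ring" if "x \<in> multiplier_ring" "y \<in> multiplier_ring" for x y
    using that by (simp add: multiplier_ring_def K_closed distrib_right coord_add)
  show "- x \<in> multiplier_ring" if "x \<in> multiplier_ring" for x
    using that by (simp add: multiplier_ring_def K_closed coord_uminus)
  show "is_subfield K" "multiplier_ring \<subseteq> K"
    by (auto simp: subfield_K multiplier_ring_def)
  show "r \<in> \<int>" if "of_rat r \<in> multiplier_ring" for r
    using coord_mult_basis_in_Ints[OF that dimension_pos dimension_pos] dimension_pos
    by (simp add: coord_scale coord_basis)
qed (rule multiplier_ring_mult denominator_multiplier_ring; assumption)+

definition mult_matrix :: "'a \<Rightarrow> int mat" where
  "mult_matrix z = mat d d (\<lambda>(i, j). \<lfloor>coord i (z * b j)\<rfloor>)"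

lemma mult_matrix_carrier: "mult_matrix z \<in> carrier_mat d d"
  by (simp add: mult_matrix_def)

lemma of_int_mult_matrix:
  assumes "z \<in> multiplier_ring" "i < d" "j < d"
  shows "of_int (mult_matrix z $$ (i, j)) = coord i (z * b j)"
  using coord_mult_basis_in_Ints[OF assms] assms(2,3) by (simp add: mult_matrix_def of_int_floor)

lemma mult_matrix_mult:
  assumes z: "z \<in> multiplier_ring" and w: "w \<in> multiplier_ring"
  shows "mult_matrix (z * w) = mult_matrix z * mult_matrix w"
proof (rule eq_matI)
  fix i j assume "i < dim_row (mult_matrix z * mult_matrix w)" "j < dim_col (mult_matrix z * mult_matrix w)"
  then have ij: "i < d" "j < d"
    by (simp_all add: mult_matrix_def)
  have "(of_int (mult_matrix (z * w) $$ (i, j)) :: rat) = coord i (z * (w * b j))"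
    using z w ij by (simp add: of_int_mult_matrix mult_closed mult.assoc)
  also have "\<dots> = (\<Sum>k<d. coord i (z * b k) * coord k (w * b j))"
    using w ij basis_in_K by (intro coord_mult_expansion K_closed) (auto simp: multiplier_ring_def)
  also have "\<dots> = of_int ((mult_matrix z * mult_matrix w) $$ (i, j))"
    using z w ij mult_matrix_carrier[of z] mult_matrix_carrier[of w]
    by (simp add: scalar_prod_def lessThan_atLeast0 flip: of_int_mult_matrix)
  finally show "mult_matrix (z * w) $$ (i, j) = (mult_matrix z * mult_matrix w) $$ (i, j)"
    unfolding of_int_eq_iff .
qed (simp_all add: mult_matrix_def)

definition tr :: "'a \<Rightarrow> rat" where
  "tr z = (\<Sum>i<d. coord i (z * b i))"

lemma tr_add: "tr (x + y) = tr x + tr y"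
  by (simp add: tr_def distrib_right coord_add sum.distrib)

lemma tr_scale: "tr (of_rat r * x) = r * tr x"
  by (simp add: tr_def mult.assoc coord_scale sum_distrib_left)

lemma tr_mult_expansion:
  assumes "w \<in> K"
  shows "tr (z * w) = (\<Sum>j<d. tr (z * b j) * coord j w)"
proof -
  have "tr (sum g J) = (\<Sum>j\<in>J. tr (g j))" for g and J :: "nat set"
    using tr_scale[of 0 0] by (induction J rule: infinite_finite_induct) (simp_all add: tr_add)
  moreover have "tr (z * w) = tr (\<Sum>j<d. of_rat (coord j w) * (z * b j))"
    by (subst basis_expansion[OF assms]) (simp add: sum_distrib_left mult.left_commute)
  ultimately show ?thesis
    by (simp only: tr_scale) (simp only: mult.commute)
qed

lemma tr_one: "tr 1 = of_nat d"
  by (simp add: tr_def coord_basis)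

lemma tr_eq_trace:
  "z \<in> multiplier_ring \<Longrightarrow> tr z = of_int (\<Sum>i<d. mult_matrix z $$ (i, i))"
  by (simp add: tr_def of_int_mult_matrix)

lemma prime_dvd_tr:
  assumes q: "prime q" and z: "z \<in> multiplier_ring" "z\<^sup>2 / of_nat q \<in> multiplier_ring"
  obtains t :: int where "tr z = of_int t" "int q dvd t"
proof -
  have "int q dvd (mult_matrix z * mult_matrix z) $$ (i, j)" if ij: "i < d" "j < d" for i j
  proof -
    have "z * z * b j = of_rat (of_nat q) * (z\<^sup>2 / of_nat q * b j)"
      using q by (simp add: power2_eq_square)
    then have "coord i (z * z * b j) = of_nat q * coord i (z\<^sup>2 / of_nat q * b j)"
      by (simp only: coord_scale)
    then have "(of_int (mult_matrix (z * z) $$ (i, j)) :: rat)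
        = of_int (int q * mult_matrix (z\<^sup>2 / of_nat q) $$ (i, j))"
      using z ij by (simp add: of_int_mult_matrix mult_closed)
    then show ?thesis
      unfolding of_int_eq_iff by (simp flip: mult_matrix_mult[OF z(1) z(1)])
  qed
  then have "int q dvd (\<Sum>i<d. mult_matrix z $$ (i, i))"
    using q by (intro prime_dvd_trace_of_square[OF _ mult_matrix_carrier]) auto
  then show ?thesis
    using that tr_eq_trace[OF z(1)] by blast
qed

definition gram_matrix :: "int mat" where
  "gram_matrix = mat d d (\<lambda>(i, j). \<Sum>k<d. mult_matrix (b i * b j) $$ (k, k))"

lemma gram_matrix_carrier: "gram_matrix \<in> carrier_mat d d"
  by (simp add: gram_matrix_def)

lemma gram_matrix_mult_coords:
  fixes v :: "int vec"
  assumes z: "z \<in> K" and v: "v \<in> carrier_vec d" "\<And>j. j < d \<Longrightarrow> coord j z = of_int (v $ j)" and i: "i < d"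
  shows "of_int ((gram_matrix *\<^sub>v v) $ i) = tr (b i * z)"
proof -
  have "(of_int ((gram_matrix *\<^sub>v v) $ i) :: rat) = (\<Sum>j<d. tr (b i * b j) * of_int (v $ j))"
    using v(1) i basis_in_multiplier_ring
    by (simp add: gram_matrix_def scalar_prod_def lessThan_atLeast0 tr_eq_trace mult_closed)
  also have "\<dots> = tr (b i * z)"
    using tr_mult_expansion[OF z, of "b i"] v(2) by simp
  finally show ?thesis .
qed

lemma det_gram_matrix_nonzero: "det gram_matrix \<noteq> 0"
proof
  assume "det gram_matrix = 0"
  then obtain v where v: "v \<in> carrier_vec d" "v \<noteq> 0\<^sub>v d" "gram_matrix *\<^sub>v v = 0\<^sub>v d"
    using det_0_iff_vec_prod_zero[OF gram_matrix_carrier] by blast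
  define z where "z = (\<Sum>j<d. of_int (v $ j) * b j)"
  have zK: "z \<in> K"
    unfolding z_def using subset_K basis_in_multiplier_ring
    by (intro subsetD[OF subset_K] sum_closed mult_closed of_int_closed) auto
  have coord_z: "coord j z = of_int (v $ j)" if j: "j < d" for j
  proof -
    have "coord j z = (\<Sum>k<d. of_int (v $ k) * coord j (b k))"
      unfolding z_def coord_sum using coord_scale[of j "of_int _"] by simp
    also have "\<dots> = (\<Sum>k<d. if j = k then of_int (v $ k) else 0)"
      using j by (intro sum.cong) (simp_all add: coord_basis)
    finally show ?thesis
      using j by simp
  qed
  have "tr (z * b i) = 0" if "i < d" for i
    using gram_matrix_mult_coords[OF zK v(1) coord_z that] v(3) that by (simp add: mult.commute)
  then have tr_z: "tr (z * w) = 0" if "w \<in> K" for w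
    using tr_mult_expansion[OF that] by simp
  have "z = 0"
    using tr_z[of "inverse z"] zK K_closed(10) tr_one dimension_pos by (cases "z = 0") auto
  then have "v = 0\<^sub>v d"
    using coord_z v(1) coord_0 by (intro eq_vecI) auto
  then show False
    using v(2) by simp
qed

lemma prime_dvd_gram_matrix_mult:
  fixes v :: "int vec"
  assumes q: "prime q" and z: "z \<in> multiplier_ring" "z\<^sup>2 / of_nat q \<in> multiplier_ring"
    and j: "j < d" and v: "v \<in> carrier_vec d" "\<And>i. i < d \<Longrightarrow> coord i (z * b j) = of_int (v $ i)" and i: "i < d"
  shows "int q dvd (gram_matrix *\<^sub>v v) $ i"
proof -
  define w where "w = b i * b j"
  have w: "w \<in> multiplier_ring"
    using i j by (simp add: w_def basis_in_multiplier_ring mult_closed)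
  have "(z * w)\<^sup>2 / of_nat q = z\<^sup>2 / of_nat q * w\<^sup>2"
    by (simp add: power_mult_distrib)
  then have "z * w \<in> multiplier_ring" "(z * w)\<^sup>2 / of_nat q \<in> multiplier_ring"
    using z w by (simp_all only: mult_closed power_closed)
  then obtain t where t: "tr (z * w) = of_int t" "int q dvd t"
    using prime_dvd_tr[OF q] by blast
  have "z * b j \<in> K"
    using z(1) basis_in_K[OF j] subset_K by (auto simp: K_closed)
  then have "of_int ((gram_matrix *\<^sub>v v) $ i) = tr (b i * (z * b j))"
    by (rule gram_matrix_mult_coords[OF _ v i])
  then have "(gram_matrix *\<^sub>v v) $ i = t"
    using t(1) by (simp add: w_def mult.left_commute)
  then show ?thesis
    using t(2) by simp
qed

lemma reduced_mod_prime:
  assumes q: "prime q" "\<not> int q dvd det gram_matrix"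
  shows "reduced_mod q"
  unfolding reduced_mod_def
proof (intro ballI impI)
  fix z assume z: "z \<in> multiplier_ring" "z\<^sup>2 / of_nat q \<in> multiplier_ring"
  have "coord k (z * b j) / of_nat q \<in> \<int>" if "k < d" "j < d" for k j
  proof -
    define v where "v = vec d (\<lambda>i. \<lfloor>coord i (z * b j)\<rfloor>)"
    have v: "v \<in> carrier_vec d"
      by (simp add: v_def)
    have coord_v: "coord i (z * b j) = of_int (v $ i)" if "i < d" for i
      using coord_mult_basis_in_Ints[OF z(1) that \<open>j < d\<close>] that by (simp add: v_def of_int_floor)
    have "int q dvd det gram_matrix * v $ k"
      using prime_dvd_gram_matrix_mult[OF q(1) z \<open>j < d\<close> v coord_v]
      by (rule dvd_det_mult_vec[OF gram_matrix_carrier v _ \<open>k < d\<close>])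
    then obtain t where "v $ k = int q * t"
      using q by (auto simp: prime_dvd_mult_iff)
    then show ?thesis
      using coord_v[OF \<open>k < d\<close>] q(1) by simp
  qed
  then show "z / of_nat q \<in> multiplier_ring"
    using z(1) coord_divide_of_nat[of _ "z * b _" q] by (simp add: multiplier_ring_def K_closed)
qed

end

lemma (in vector_space) finite_independent_coordinates:
  assumes finite_B: "finite B" and independent_B: "independent B"
  obtains b :: "nat \<Rightarrow> 'b" and coord :: "nat \<Rightarrow> 'b \<Rightarrow> 'a" where
    "\<And>i. i < card B \<Longrightarrow> b i \<in> B" "\<And>i x y. coord i (x + y) = coord i x + coord i y"
    "\<And>i r x. coord i (r *s x) = r * coord i x"
    "\<And>i j. i < card B \<Longrightarrow> j < card B \<Longrightarrow> coord i (b j) = of_bool (i = j)"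
    "\<And>z. z \<in> span B \<Longrightarrow> z = (\<Sum>j<card B. coord j z *s b j)"
proof -
  obtain b where bij: "bij_betw b {..<card B} B"
    using ex_bij_betw_nat_finite[OF finite_B] by (auto simp: lessThan_atLeast0)
  have b_in_B: "b i \<in> B" if "i < card B" for i
    using bij_betwE[OF bij] that by simp
  define W where "W = extend_basis B"
  have W: "independent W" "span W = UNIV" "B \<subseteq> W"
    using independent_extend_basis span_extend_basis extend_basis_superset independent_B
    by (simp_all add: W_def)
  \<comment> \<open>Coordinates with respect to a basis of the whole ambient space are linear everywhere.\<close>
  define coord where "coord i x = representation W x (b i)" for i x
  show ?thesis
  proof (rule that[of b coord])
    show "coord i (x + y) = coord i x + coord i y" "coord i (r *s x) = r * coord i x" for i x y r
      using W by (simp_all add: coord_def representation_add representation_scale)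
    show "coord i (b j) = of_bool (i = j)" if "i < card B" "j < card B" for i j
    proof -
      have "b i = b j \<longleftrightarrow> i = j"
        using bij that by (auto simp: bij_betw_def inj_on_def)
      then show ?thesis
        using representation_basis[OF W(1)] b_in_B[OF that(2)] W(3) by (auto simp: coord_def)
    qed
    fix z assume z: "z \<in> span B"
    have "z = (\<Sum>v\<in>B. representation B z v *s v)"
      by (rule sum_representation_eq[OF independent_B z finite_B order_refl, symmetric])
    also have "\<dots> = (\<Sum>j<card B. representation B z (b j) *s b j)"
      by (rule sum.reindex_bij_betw[OF bij, symmetric])
    also have "representation B z = representation W z"
      by (rule representation_extend[OF W(1) z W(3), symmetric])
    finally show "z = (\<Sum>j<card B. coord j z *s b j)"
      by (simp add: coord_def)
  qed (rule b_in_B)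
qed

lemma integral_basis_exists:
  fixes K :: "'a::field_char_0 set"
  assumes "number_field K"
  obtains d b coord where "integral_basis K d b coord"
proof -
  have K: "is_subfield K"
    using assms by (simp add: number_field_def)
  obtain B where B: "finite B" "rat.independent B" "rat.span B = K"
    by (rule number_field_finite_basis[OF assms])
  define d where "d = card B"
  obtain e :: "nat \<Rightarrow> 'a" and c :: "nat \<Rightarrow> 'a \<Rightarrow> rat" where
    e_in: "\<And>i. i < d \<Longrightarrow> e i \<in> B" and c_add: "\<And>i x y. c i (x + y) = c i x + c i y"
    and c_scale: "\<And>i r x. c i (of_rat r * x) = r * c i x"
    and c_basis: "\<And>i j. i < d \<Longrightarrow> j < d \<Longrightarrow> c i (e j) = of_bool (i = j)"
    and c_expansion: "\<And>z. z \<in> K \<Longrightarrow> z = (\<Sum>j<d. of_rat (c j z) * e j)"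
    using rat.finite_independent_coordinates[OF B(1,2)] unfolding B(3) d_def by blast
  have e_in_K: "e i \<in> K" if "i < d" for i
    using e_in[OF that] B(3) rat.span_base by blast
  have "finite ((\<lambda>(i, j, k). c k (e i * e j)) ` ({..<d} \<times> {..<d} \<times> {..<d}))"
    by simp
  from rat_common_denominator[OF this]
  obtain n :: nat where n: "n > 0" "\<And>i j k. i < d \<Longrightarrow> j < d \<Longrightarrow> k < d \<Longrightarrow> of_nat n * c k (e i * e j) \<in> \<int>"
    by auto
  have c_scale_nat: "c i (of_nat n * x) = of_nat n * c i x" for i x
    using c_scale[of i "of_nat n" x] by simp
  have "integral_basis K d (\<lambda>i. of_nat n * e i) (\<lambda>i x. c i x / of_nat n)"
  proof (rule integral_basis.intro)
    show "z = (\<Sum>j<d. of_rat (c j z / of_nat n) * (of_nat n * e j))" if "z \<in> K" for z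
      using c_expansion[OF that] n(1) by (simp add: of_rat_divide)
    show "c k (of_nat n * e i * (of_nat n * e j)) / of_nat n \<in> \<int>" if "i < d" "j < d" "k < d" for i j k
      using n(2)[OF that] n(1) by (simp add: c_scale_nat mult.assoc mult.left_commute[of "e i"])
  qed (use K n(1) in \<open>simp_all add: c_add c_scale c_scale_nat c_basis e_in_K subfield_closed add_divide_distrib\<close>)
  then show ?thesis
    by (rule that)
qed

corollary number_field_order_exists:
  fixes K :: "'a::field_char_0 set"
  assumes "number_field K"
  obtains R N where "number_field_order R K" "N > 0"
    "\<And>q. prime q \<Longrightarrow> \<not> q dvd N \<Longrightarrow> number_field_order.reduced_mod R q"
proof -
  obtain d b coord where "integral_basis K d b coord"
    using integral_basis_exists[OF assms] by blast
  then interpret integral_basis K d b coord .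
  show ?thesis
  proof (rule that[of multiplier_ring "nat \<bar>det gram_matrix\<bar>"])
    show "reduced_mod q" if "prime q" "\<not> q dvd nat \<bar>det gram_matrix\<bar>" for q
      using that by (intro reduced_mod_prime) (simp_all add: nat_dvd_iff)
  qed (use det_gram_matrix_nonzero in \<open>simp_all add: number_field_order_axioms\<close>)
qed

section \<open>Points of infinite order\<close>

lemma (in group) ord_eq_0_of_distinct_doublings:
  assumes P: "P \<in> carrier G" and distinct: "\<And>j k. j < k \<Longrightarrow> P [^] (2 ^ j :: nat) \<noteq> P [^] (2 ^ k :: nat)"
  shows "ord P = 0"
proof (rule ccontr)
  assume "ord P \<noteq> 0"
  then have "range (\<lambda>k. 2 ^ k mod ord P) \<subseteq> {..<ord P}"
    by auto
  then have "\<not> inj (\<lambda>k. 2 ^ k mod ord P)"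
    using finite_imageD[of "\<lambda>k. 2 ^ k mod ord P" UNIV] finite_subset by blast
  then obtain j k where jk: "j < k" "2 ^ j mod ord P = 2 ^ k mod ord P"
    using linorder_injI[of "\<lambda>k. 2 ^ k mod ord P"] by metis
  then have "ord P dvd 2 ^ k - 2 ^ j"
    using mod_eq_dvd_iff_nat[of "2 ^ j" "2 ^ k" "ord P"] by simp
  then have "P [^] (2 ^ k - 2 ^ j :: nat) = \<one>"
    using pow_eq_id[OF P] by simp
  then have "P [^] (2 ^ j :: nat) = P [^] (2 ^ k :: nat)"
    using nat_pow_mult[OF P, of "2 ^ k - 2 ^ j" "2 ^ j"] P jk(1) by simp
  then show False
    using distinct[OF jk(1)] by blast
qed

locale odd_subring = unital_subring R for R :: "'a::field_char_0 set" +
  assumes half_notin: "1 / 2 \<notin> R"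
begin

definition even_elem :: "'a \<Rightarrow> bool" where "even_elem x \<longleftrightarrow> x / 2 \<in> R"
definition odd_elem :: "'a \<Rightarrow> bool" where "odd_elem x \<longleftrightarrow> even_elem (x - 1)"

lemma even_elem_add: "even_elem x \<Longrightarrow> even_elem y \<Longrightarrow> even_elem (x + y)"
  by (simp add: even_elem_def add_divide_distrib add_closed)

lemma even_elem_diff: "even_elem x \<Longrightarrow> even_elem y \<Longrightarrow> even_elem (x - y)"
  by (simp add: even_elem_def diff_divide_distrib diff_closed)

lemma even_elem_mult: "x \<in> R \<Longrightarrow> even_elem y \<Longrightarrow> even_elem (x * y)"
  unfolding even_elem_def times_divide_eq_right[symmetric] by (rule mult_closed)

lemma even_elem_in: "even_elem x \<Longrightarrow> x \<in> R"
  using add_closed[of "x / 2" "x / 2"] by (simp add: even_elem_def)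

lemma odd_elem_one: "odd_elem 1"
  by (simp add: odd_elem_def even_elem_def zero_closed)

lemma odd_elem_add_even: "odd_elem x \<Longrightarrow> even_elem y \<Longrightarrow> odd_elem (x + y)"
  using even_elem_add[of "x - 1" y] by (simp add: odd_elem_def algebra_simps)

lemma odd_elem_in: "odd_elem x \<Longrightarrow> x \<in> R"
  using add_closed[OF even_elem_in one_closed, of "x - 1"] by (simp add: odd_elem_def)

lemma odd_elem_mult: "odd_elem x \<Longrightarrow> odd_elem y \<Longrightarrow> odd_elem (x * y)"
  using odd_elem_add_even[OF _ even_elem_mult[OF odd_elem_in, of x "y - 1"], of x] by (simp add: odd_elem_def algebra_simps)

lemma odd_elem_power: "odd_elem x \<Longrightarrow> odd_elem (x ^ n)"
  by (induction n) (auto intro: odd_elem_one odd_elem_mult)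

lemma odd_elem_not_even: "odd_elem x \<Longrightarrow> \<not> even_elem x"
  using even_elem_diff[of x "x - 1"] half_notin by (auto simp: odd_elem_def even_elem_def)

lemma odd_elem_nonzero: "odd_elem x \<Longrightarrow> x \<noteq> 0"
  using odd_elem_not_even[of x] zero_closed by (auto simp: even_elem_def)

end

lemma (in number_field_order) odd_subring: "odd_subring R"
proof
  show "1 / 2 \<notin> R"
    using dvd_if_quotient_in[of 2 1] by auto
qed

lemma (in nonsingular_cubic) add_self:
  assumes P: "y\<^sup>2 = f x" and y: "y \<noteq> 0"
  obtains y' where
    "Affine x y \<boxplus> Affine x y = Affine ((x ^ 4 - 2 * b * x\<^sup>2 - 8 * c * x + b\<^sup>2 - 4 * a * c) / (4 * f x)) y'"
proof -
  have "Affine x y \<in> C" "Affine x y \<noteq> neg_point (Affine x y)"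
    using P y by (auto simp: equal_neg_zero)
  then obtain l v x3 where y_eq: "y = l * x + v" and line: "line_meets l v x x x3"
    using line_through[of x y x y] by metis
  have "4 * f x * x3 = (2 * y * l)\<^sup>2 - 4 * f x * (a + 2 * x)"
    unfolding line_meetsD(1)[OF line] P[symmetric] by (simp add: algebra_simps power2_eq_square)
  also have "\<dots> = x ^ 4 - 2 * b * x\<^sup>2 - 8 * c * x + b\<^sup>2 - 4 * a * c"
    unfolding line_meets_tangent[OF line, folded y_eq, symmetric] cubic_def
    by (simp add: algebra_simps power2_eq_square power3_eq_cube power4_eq_xxxx)
  finally have "x3 = (x ^ 4 - 2 * b * x\<^sup>2 - 8 * c * x + b\<^sup>2 - 4 * a * c) / (4 * f x)"
    using y by (simp add: eq_divide_eq mult.commute flip: P)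
  then show ?thesis
    using that add_collinear[OF line] unfolding y_eq[symmetric] by blast
qed

locale cubic_over_odd_subring = nonsingular_cubic a b c + odd_subring R
  for a b c :: "'a::{field_char_0, alg_closed_field}" and R :: "'a set"
begin

definition even_denominator :: "'a \<Rightarrow> bool" where
  "even_denominator T \<longleftrightarrow> T \<noteq> 0 \<and> even_elem T \<and> even_elem (T * a) \<and> even_elem (T * b) \<and> even_elem (T * c)"

definition odd_over :: "'a \<Rightarrow> 'a ec_point \<Rightarrow> bool" where
  "odd_over T P \<longleftrightarrow> P \<in> C \<and> (\<exists>s y. odd_elem s \<and> P = Affine (s / T) y)"

lemma even_denominator_mult:
  assumes "even_denominator T" "v \<in> R" "v \<noteq> 0"
  shows "even_denominator (v * T)"
  using assms by (simp add: even_denominator_def even_elem_mult mult.assoc)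

text \<open>Doubling multiplies the \<open>x\<close>-coordinate by \<open>1/4\<close> times a \<open>2\<close>-adic unit.\<close>

lemma double_odd_over:
  assumes T: "even_denominator T" and P: "odd_over T P"
  obtains g where "odd_elem g" "odd_over (4 * g * T) (P \<boxplus> P)"
proof -
  obtain s y where s: "odd_elem s" and P_eq: "P = Affine (s / T) y" and on: "y\<^sup>2 = f (s / T)"
    using P by (auto simp: odd_over_def)
  have T0: "T \<noteq> 0" and TE: "even_elem T" "even_elem (T * a)" "even_elem (T * b)" "even_elem (T * c)"
    using T by (auto simp: even_denominator_def)
  note in_R = closed odd_elem_in[OF s] TE[THEN even_elem_in]
  define g where "g = s ^ 3 + (s\<^sup>2 * (T * a) + s * T * (T * b) + T\<^sup>2 * (T * c))"
  define n where "n = s ^ 4 + (T\<^sup>2 * (T * b) * (T * b) - 2 * s\<^sup>2 * T * (T * b)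
      - 8 * s * T\<^sup>2 * (T * c) - 4 * T\<^sup>2 * (T * a) * (T * c))"
  have g: "odd_elem g"
    unfolding g_def by (intro odd_elem_add_even odd_elem_power even_elem_add even_elem_mult s TE in_R)
  have n: "odd_elem n"
    unfolding n_def by (intro odd_elem_add_even odd_elem_power even_elem_diff even_elem_mult s TE in_R)
  have fx: "f (s / T) = g / T ^ 3"
    using T0 unfolding cubic_def g_def by (simp add: field_simps power2_eq_square power3_eq_cube)
  then have "y \<noteq> 0"
    using on T0 odd_elem_nonzero[OF g] by auto
  then obtain y' where "P \<boxplus> P = Affine (((s / T) ^ 4 - 2 * b * (s / T)\<^sup>2 - 8 * c * (s / T) + b\<^sup>2 - 4 * a * c)
      / (4 * f (s / T))) y'"
    using add_self[OF on] unfolding P_eq by blast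
  moreover have "(s / T) ^ 4 - 2 * b * (s / T)\<^sup>2 - 8 * c * (s / T) + b\<^sup>2 - 4 * a * c = n / T ^ 4"
    using T0 unfolding n_def by (simp add: field_simps power2_eq_square power4_eq_xxxx)
  moreover have "n / T ^ 4 / (4 * (g / T ^ 3)) = n / (4 * g * T)"
    using T0 odd_elem_nonzero[OF g] by (simp add: field_simps power3_eq_cube power4_eq_xxxx)
  ultimately have "P \<boxplus> P = Affine (n / (4 * g * T)) y'"
    by (simp only: fx)
  moreover have "P \<boxplus> P \<in> C"
    using P by (simp add: odd_over_def add_point_in_C)
  ultimately show ?thesis
    using that[OF g] n unfolding odd_over_def by blast
qed

lemma iterated_double_odd_over:
  assumes T: "even_denominator T" and P: "odd_over T P"
  shows "\<exists>g. odd_elem g \<and> odd_over (4 ^ k * g * T) (((\<lambda>P. P \<boxplus> P) ^^ k) P)"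
proof (induction k)
  case 0
  then show ?case
    using P odd_elem_one by (intro exI[of _ 1]) simp
next
  case (Suc k)
  then obtain g where g: "odd_elem g" "odd_over (4 ^ k * g * T) (((\<lambda>P. P \<boxplus> P) ^^ k) P)"
    by blast
  have "even_denominator (4 ^ k * g * T)"
    using g odd_elem_nonzero by (intro even_denominator_mult[OF T] closed odd_elem_in) auto
  from double_odd_over[OF this g(2)]
  obtain h where "odd_elem h" "odd_over (4 * h * (4 ^ k * g * T)) (((\<lambda>P. P \<boxplus> P) ^^ Suc k) P)"
    by auto
  then show ?case
    using odd_elem_mult[OF g(1), of h] by (intro exI[of _ "g * h"]) (simp add: ac_simps)
qed

lemma iterated_double_neq:
  assumes T: "even_denominator T" and P: "odd_over T P" and "k > 0"
  shows "((\<lambda>P. P \<boxplus> P) ^^ k) P \<noteq> P"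
proof
  assume fixed: "((\<lambda>P. P \<boxplus> P) ^^ k) P = P"
  obtain s y where s: "odd_elem s" "P = Affine (s / T) y"
    using P by (auto simp: odd_over_def)
  obtain g s' y' where g: "odd_elem g" "odd_elem s'" "P = Affine (s' / (4 ^ k * g * T)) y'"
    using iterated_double_odd_over[OF T P, of k] unfolding fixed odd_over_def by blast
  have "s * (g * 4 ^ k) = s'"
    using s(2) g T odd_elem_nonzero[OF g(1)] by (simp add: even_denominator_def field_simps)
  moreover have "even_elem (4 ^ k)"
    using \<open>k > 0\<close> closed by (cases k) (simp_all add: even_elem_def)
  ultimately have "even_elem s'"
    using s(1) g(1) by (metis even_elem_mult odd_elem_in)
  then show False
    using g(2) odd_elem_not_even by blast
qed

lemma ord_eq_0:
  assumes L: "is_subfield L" and abc: "a \<in> L" "b \<in> L" "c \<in> L"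
    and P: "P \<in> points L" and T: "even_denominator T" "odd_over T P"
  shows "group.ord (point_group L) P = 0"
proof -
  define G where "G = point_group L"
  interpret G: comm_group G
    unfolding G_def by (rule comm_group_cubic_curve[OF L abc])
  have P_in: "P \<in> carrier G"
    using P by (simp add: G_def)
  define D where "D k = ((\<lambda>P. P \<boxplus> P) ^^ k) P" for k
  have power: "P [^]\<^bsub>G\<^esub> (2 ^ k :: nat) = D k" for k
  proof (induction k)
    case (Suc k)
    have "P [^]\<^bsub>G\<^esub> (2 ^ Suc k :: nat) = P [^]\<^bsub>G\<^esub> (2 ^ k :: nat) \<otimes>\<^bsub>G\<^esub> P [^]\<^bsub>G\<^esub> (2 ^ k :: nat)"
      using G.nat_pow_mult[OF P_in, of "2 ^ k" "2 ^ k"] by (simp add: mult_2)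
    then show ?case
      unfolding Suc by (simp add: D_def G_def)
  qed (use P_in in \<open>simp add: D_def\<close>)
  have "D j \<noteq> D k" if "j < k" for j k
  proof -
    obtain g where g: "odd_elem g" "odd_over (4 ^ j * g * T) (D j)"
      using iterated_double_odd_over[OF T] by (auto simp: D_def)
    then have "even_denominator (4 ^ j * g * T)"
      using odd_elem_nonzero by (intro even_denominator_mult[OF T(1)] closed odd_elem_in) auto
    moreover have "D k = ((\<lambda>P. P \<boxplus> P) ^^ (k - j)) (D j)"
      using that by (simp add: D_def flip: funpow_add[THEN fun_cong, unfolded comp_def])
    ultimately show ?thesis
      using iterated_double_neq[OF _ g(2), of "k - j"] that by simp
  qed
  then have "G.ord P = 0"
    by (intro G.ord_eq_0_of_distinct_doublings P_in) (simp add: power)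
  then show ?thesis
    by (simp add: G_def)
qed

end

lemma exists_prime_not_dvd:
  fixes n :: nat
  assumes "n > 0"
  shows "\<exists>q. prime q \<and> \<not> q dvd n"
  using bigger_prime[of n] assms nat_dvd_not_less by blast

lemma (in unital_subring) cubic_value_clear_denominators:
  assumes T: "T \<noteq> 0" "T \<in> R" and n: "n \<in> R" "n * a \<in> R" "n * b \<in> R" "n * c \<in> R" "n * D \<in> R"
  obtains h where "h \<in> R" "n ^ 4 * T ^ 4 * cubic a b c (D + 1 / T) = T * n * (n ^ 3 + T * h)"
proof -
  define S where "S = n + T * (n * D)"
  define h where "h = n * D * (S\<^sup>2 + S * n + n\<^sup>2) + n * a * S\<^sup>2 + n * (n * b) * S * T + n\<^sup>2 * (n * c) * T\<^sup>2"
  have "S \<in> R"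
    unfolding S_def by (intro closed T n)
  then have h: "h \<in> R"
    unfolding h_def by (intro closed T n)
  define x where "x = D + 1 / T"
  have S: "S = n * T * x"
    using T(1) by (simp add: S_def x_def algebra_simps)
  have "n ^ 4 * T ^ 4 * cubic a b c x
      = T * n * (S ^ 3 + n * a * S\<^sup>2 * T + n * (n * b) * S * T\<^sup>2 + n\<^sup>2 * (n * c) * T ^ 3)"
    unfolding S cubic_def by (simp add: algebra_simps power2_eq_square power3_eq_cube power4_eq_xxxx)
  also have "S ^ 3 = n ^ 3 + T * (n * D) * (S\<^sup>2 + S * n + n\<^sup>2)"
    by (simp add: S_def algebra_simps power2_eq_square power3_eq_cube)
  also have "T * n * (n ^ 3 + T * (n * D) * (S\<^sup>2 + S * n + n\<^sup>2) + n * a * S\<^sup>2 * T + n * (n * b) * S * T\<^sup>2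
      + n\<^sup>2 * (n * c) * T ^ 3) = T * n * (n ^ 3 + T * h)"
    by (simp add: h_def algebra_simps power2_eq_square power3_eq_cube)
  finally show ?thesis
    using that[OF h] by (simp add: x_def)
qed

lemma (in number_field_order) cubic_value_not_square:
  assumes q: "prime q" "reduced_mod q" "\<not> q dvd t * N" and t: "t > 0"
    and denominators: "of_nat N * a \<in> R" "of_nat N * b \<in> R" "of_nat N * c \<in> R" "of_nat N * D \<in> R"
    and y: "y \<in> K"
  shows "y\<^sup>2 \<noteq> cubic a b c (D + 1 / of_nat (t * q))"
proof
  assume square: "y\<^sup>2 = cubic a b c (D + 1 / of_nat (t * q))"
  have "(of_nat (t * q) :: 'a) \<noteq> 0"
    using t q(1) by auto
  then obtain h where h: "h \<in> R" "of_nat N ^ 4 * of_nat (t * q) ^ 4 * cubic a b c (D + 1 / of_nat (t * q))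
      = of_nat (t * q) * of_nat N * (of_nat N ^ 3 + of_nat (t * q) * h)"
    by (rule cubic_value_clear_denominators[OF _ of_nat_closed of_nat_closed denominators])
  define w where "w = of_nat (N\<^sup>2 * (t * q)\<^sup>2) * y"
  have "w\<^sup>2 = of_nat N ^ 4 * of_nat (t * q) ^ 4 * cubic a b c (D + 1 / of_nat (t * q))"
    by (simp add: w_def power_mult_distrib square flip: power_mult)
  also have "\<dots> = of_nat q * (of_nat (t * N ^ 4) + of_nat q * (of_nat (t\<^sup>2 * N) * h))"
    unfolding h(2) by (simp add: algebra_simps power2_eq_square power3_eq_cube power4_eq_xxxx)
  finally have "w\<^sup>2 = of_nat q * (of_nat (t * N ^ 4) + of_nat q * (of_nat (t\<^sup>2 * N) * h))" .
  moreover have "w \<in> K"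
    unfolding w_def using y by (intro subfield_closed[OF subfield_K])
  moreover have "of_nat (t\<^sup>2 * N) * h \<in> R"
    by (intro closed h(1))
  ultimately have "q dvd t * N ^ 4"
    using prime_dvd_of_square_eq[OF q(1,2)] by blast
  then show False
    using q by (auto simp: prime_dvd_mult_iff dest: prime_dvd_power)
qed

lemma (in cubic_over_odd_subring) odd_over_shift:
  assumes "even_denominator T" "even_elem (T * D)" "Affine (D + 1 / T) y \<in> C"
  shows "odd_over T (Affine (D + 1 / T) y)"
proof -
  have "D + 1 / T = (1 + T * D) / T"
    using assms(1) by (simp add: even_denominator_def field_simps)
  moreover have "odd_elem (1 + T * D)"
    using assms(2) by (intro odd_elem_add_even odd_elem_one)
  ultimately show ?thesis
    using assms(3) unfolding odd_over_def by metis
qed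

lemma (in nonsingular_cubic) exists_generic_x:
  assumes F: "number_field F" and abcD: "a \<in> F" "b \<in> F" "c \<in> F" "D \<in> F"
  shows "\<exists>m::nat. (\<forall>y\<in>F. y\<^sup>2 \<noteq> f (D + 1 / of_nat m)) \<and>
    (\<forall>L y. is_subfield L \<and> a \<in> L \<and> b \<in> L \<and> c \<in> L \<and> Affine (D + 1 / of_nat m) y \<in> points L
      \<longrightarrow> group.ord (point_group L) (Affine (D + 1 / of_nat m) y) = 0)"
proof -
  obtain R \<Delta> where "number_field_order R F" and \<Delta>: "\<Delta> > 0"
    and reduced: "\<And>q. prime q \<Longrightarrow> \<not> q dvd \<Delta> \<Longrightarrow> number_field_order.reduced_mod R q"
    using number_field_order_exists[OF F] by blast
  then interpret number_field_order R F by blast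
  interpret cubic_over_odd_subring a b c R
    by (intro cubic_over_odd_subring.intro odd_subring nonsingular_cubic_axioms)
  obtain N where N: "N > 0" "\<And>z. z \<in> {a, b, c, D} \<Longrightarrow> of_nat N * z \<in> R"
    using common_denominator[of "{a, b, c, D}"] abcD by auto
  obtain q where q: "prime q" "\<not> q dvd 2 * N * N * \<Delta>"
    using exists_prime_not_dvd[of "2 * N * N * \<Delta>"] N(1) \<Delta> by auto
  then have not_dvd: "\<not> q dvd 2 * N * N" "\<not> q dvd \<Delta>"
    by auto
  define m where "m = 2 * N * q"
  have T_even: "even_elem (of_nat m * z)" if "of_nat N * z \<in> R" for z
    using mult_closed[OF of_nat_closed[of q] that] by (simp add: even_elem_def m_def ac_simps)
  have T: "even_denominator (of_nat m)"
    using T_even[of 1] T_even N q(1) unfolding even_denominator_def by (auto simp: m_def of_nat_closed)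
  show ?thesis
  proof (intro exI[of _ m] conjI ballI allI impI)
    show "y\<^sup>2 \<noteq> f (D + 1 / of_nat m)" if "y \<in> F" for y
      using q(1) not_dvd N reduced that unfolding m_def by (intro cubic_value_not_square) auto
    fix L y
    assume L: "is_subfield L \<and> a \<in> L \<and> b \<in> L \<and> c \<in> L \<and> Affine (D + 1 / of_nat m) y \<in> points L"
    then have "Affine (D + 1 / of_nat m) y \<in> C"
      using ec_points_iff by blast
    then have "odd_over (of_nat m) (Affine (D + 1 / of_nat m) y)"
      using T_even N(2) by (intro odd_over_shift[OF T]) simp_all
    then show "group.ord (point_group L) (Affine (D + 1 / of_nat m) y) = 0"
      using L by (intro ord_eq_0[OF _ _ _ _ _ T]) auto
  qed
qed

section \<open>Complex conjugations\<close>

locale complex_conjugation_automorphism =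
  fixes K :: "'a::{field_char_0, alg_closed_field} set" and \<sigma> :: "'a \<Rightarrow> 'a"
  assumes complex_conjugation: "complex_conjugation K \<sigma>"
begin

lemma is_subfield_UNIV: "is_subfield (UNIV :: 'a set)"
  by (simp add: is_subfield_iff)

lemma in_Gal: "\<sigma> \<in> carrier (Gal UNIV K)"
  using complex_conjugation by (simp add: complex_conjugation_def)

lemmas hom = Gal_hom[OF is_subfield_UNIV in_Gal, simplified]
lemmas hom_power = Gal_power[OF is_subfield_UNIV in_Gal, simplified]

lemma involution: "\<sigma> (\<sigma> x) = x" and nontrivial: "\<exists>z. \<sigma> z \<noteq> z"
proof -
  interpret group "Gal UNIV K"
    by (rule group_Gal[OF is_subfield_UNIV]) simp
  have ord: "ord \<sigma> = 2"
    using complex_conjugation by (simp add: complex_conjugation_def)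
  have one: "\<one>\<^bsub>Gal UNIV K\<^esub> = id"
    by (auto simp: Gal_def BijGroup_def)
  have "\<sigma> \<otimes>\<^bsub>Gal UNIV K\<^esub> \<sigma> = \<one>\<^bsub>Gal UNIV K\<^esub>"
    using pow_ord_eq_1[OF in_Gal] in_Gal by (simp add: ord numeral_2_eq_2)
  then have "compose UNIV \<sigma> \<sigma> = id"
    using in_Gal unfolding one by (simp add: Gal_def BijGroup_def)
  then show "\<sigma> (\<sigma> x) = x"
    by (metis UNIV_I compose_eq id_apply)
  show "\<exists>z. \<sigma> z \<noteq> z"
    using ord_eq_1[OF in_Gal] ord one by auto
qed

lemma square_root_exists: "\<exists>w. w\<^sup>2 = (z::'a)"
  using nth_root_exists[of 2 z] by auto

lemma imaginary_unit:
  assumes i: "i\<^sup>2 = -1"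
  shows "\<sigma> i = - i"
proof (rule ccontr)
  assume "\<sigma> i \<noteq> - i"
  moreover have "(\<sigma> i)\<^sup>2 = i\<^sup>2"
    using hom_power[of i 2] i by (simp add: hom)
  ultimately have fixed: "\<sigma> i = i"
    using power2_eq_iff by blast
  obtain z0 where "\<sigma> z0 \<noteq> z0"
    using nontrivial by blast
  define z where "z = z0 - \<sigma> z0"
  have z: "z \<noteq> 0" "\<sigma> z = - z"
    using \<open>\<sigma> z0 \<noteq> z0\<close> by (simp_all add: z_def hom involution)
  obtain w where w: "w\<^sup>2 = z"
    using square_root_exists by blast
  have "(\<sigma> w)\<^sup>2 = (i * w)\<^sup>2"
    using z(2) by (simp add: w i power_mult_distrib flip: hom_power)
  then have "\<sigma> w = i * w \<or> \<sigma> w = - (i * w)"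
    using power2_eq_iff by blast
  then have "\<sigma> (\<sigma> w) = i\<^sup>2 * w"
    by (auto simp: hom fixed power2_eq_square)
  then have "w = 0"
    by (simp add: involution i equal_neg_zero)
  then show False
    using w z by simp
qed

definition nonneg :: "'a set" where
  "nonneg = {z\<^sup>2 | z. \<sigma> z = z}"

lemma square_nonneg: "\<sigma> z = z \<Longrightarrow> z\<^sup>2 \<in> nonneg"
  by (auto simp: nonneg_def)

lemma nonneg_fixed: "x \<in> nonneg \<Longrightarrow> \<sigma> x = x"
  by (auto simp: nonneg_def hom)

lemma nonneg_mult: "x \<in> nonneg \<Longrightarrow> y \<in> nonneg \<Longrightarrow> x * y \<in> nonneg"
  unfolding nonneg_def using Gal_mult[OF is_subfield_UNIV in_Gal] by (auto simp flip: power_mult_distrib)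

text \<open>A sum \<open>u\<^sup>2 + v\<^sup>2\<close> of two squares is the square of \<open>w * \<sigma> w\<close>, where \<open>w\<^sup>2 = u + i * v\<close>.\<close>

lemma nonneg_add:
  assumes "x \<in> nonneg" "y \<in> nonneg"
  shows "x + y \<in> nonneg"
proof -
  obtain u v where uv: "x = u\<^sup>2" "\<sigma> u = u" "y = v\<^sup>2" "\<sigma> v = v"
    using assms by (auto simp: nonneg_def)
  obtain i where i: "i\<^sup>2 = (-1::'a)"
    using square_root_exists by blast
  obtain w where w: "w\<^sup>2 = u + i * v"
    using square_root_exists by blast
  have "(\<sigma> w)\<^sup>2 = u - i * v"
    using imaginary_unit[OF i] by (simp add: w uv hom flip: hom_power)
  then have "(w * \<sigma> w)\<^sup>2 = (u + i * v) * (u - i * v)"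
    by (simp add: w power_mult_distrib)
  also have "\<dots> = u\<^sup>2 - i\<^sup>2 * v\<^sup>2"
    by (simp add: algebra_simps power2_eq_square)
  finally have "(w * \<sigma> w)\<^sup>2 = x + y"
    by (simp add: i uv)
  moreover have "\<sigma> (w * \<sigma> w) = w * \<sigma> w"
    by (simp add: hom involution)
  ultimately show ?thesis
    using square_nonneg by metis
qed

lemma of_nat_nonneg: "of_nat n \<in> nonneg"
proof (induction n)
  case 0
  then show ?case
    using square_nonneg[of 0] by (simp add: hom)
next
  case (Suc n)
  then show ?case
    using nonneg_add[OF square_nonneg[of 1]] by (simp add: hom)
qed

lemma inverse_of_nat_nonneg: "1 / of_nat n \<in> nonneg"
proof (cases "n = 0")
  case False
  have "(1 / of_nat n)\<^sup>2 * of_nat n \<in> nonneg"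
    by (intro nonneg_mult square_nonneg of_nat_nonneg) (simp add: hom)
  then show ?thesis
    using False by (simp add: power2_eq_square)
qed (use of_nat_nonneg[of 0] in simp)

lemma cubic_value_nonneg:
  assumes fixed: "\<sigma> a = a" "\<sigma> b = b" "\<sigma> c = c" and r: "r \<in> nonneg"
    and x: "x = 1 + a\<^sup>2 + b\<^sup>2 + c\<^sup>2 + r"
  shows "cubic a b c x \<in> nonneg"
proof -
  have one: "1 \<in> nonneg" and three: "3 \<in> nonneg"
    using of_nat_nonneg[of 1] of_nat_nonneg[of 3] by simp_all
  have d: "x - 1 \<in> nonneg"
    unfolding x using r by (auto intro!: nonneg_add square_nonneg fixed simp: algebra_simps)
  then have xn: "x \<in> nonneg" "x + 1 \<in> nonneg"
    using nonneg_add[OF _ one, of "x - 1"] nonneg_add[OF _ one, of x] by simp_all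
  have "cubic a b c x = x\<^sup>2 * (a + 1 / 2)\<^sup>2 + (b * x + 1 / 2)\<^sup>2 + (c + 1 / 2)\<^sup>2
      + (x - 1) * (x + 1) * c\<^sup>2 + 3 * (1 / 2)\<^sup>2 * ((x - 1) * (x + 1)) + (1 / 2)\<^sup>2 + r * x\<^sup>2"
  proof -
    have "cubic a b c x = x\<^sup>2 * (1 + a\<^sup>2 + b\<^sup>2 + c\<^sup>2 + r) + a * x\<^sup>2 + b * x + c"
      unfolding x[symmetric] by (simp add: cubic_def power2_eq_square power3_eq_cube)
    then show ?thesis
      by (simp add: field_simps power2_eq_square)
  qed
  also have "\<dots> \<in> nonneg"
    using nonneg_fixed[OF xn(1)]
    by (intro nonneg_add nonneg_mult square_nonneg r d xn three) (simp_all add: hom fixed)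
  finally show ?thesis .
qed

end

section \<open>Infinite rank\<close>

context complex_conjugation_automorphism
begin

lemma is_subfield_fixed_field:
  assumes "is_subfield M"
  shows "is_subfield (fixed_field M \<sigma>)"
  using assms unfolding is_subfield_iff fixed_field_def by (auto simp: hom)

lemma square_root_in_max_abelian_extension:
  assumes K: "is_subfield K" and "y\<^sup>2 \<in> K"
  shows "y \<in> max_abelian_extension K"
proof (cases "y \<in> K")
  case True
  then show ?thesis
    using abelian_extension_subset_max[OF abelian_extension_refl[OF K]] by blast
next
  case False
  then interpret quadratic_generator K y
    using assms by (intro quadratic_generator.intro)
  show ?thesis
    using abelian_extension_subset_max[OF abelian_extension] extension_superset(2) by blast
qed

abbreviation fixed_max_abelian :: "'a set" where
  "fixed_max_abelian \<equiv> fixed_field (max_abelian_extension K) \<sigma>"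

lemma is_subfield_fixed_max_abelian: "is_subfield fixed_max_abelian"
  by (intro is_subfield_fixed_field is_subfield_max_abelian_extension)

lemma fixed_square_root_in_fixed_max_abelian:
  "is_subfield K \<Longrightarrow> \<sigma> y = y \<Longrightarrow> y\<^sup>2 \<in> K \<Longrightarrow> y \<in> fixed_max_abelian"
  using square_root_in_max_abelian_extension by (simp add: fixed_field_def)

lemma subset_fixed_max_abelian: "is_subfield K \<Longrightarrow> K \<subseteq> fixed_max_abelian"
  using fixed_square_root_in_fixed_max_abelian Gal_fixed[OF is_subfield_UNIV in_Gal] subfield_closed(11)
  by blast

end

locale cubic_with_conjugation = complex_conjugation_automorphism K \<sigma> + nonsingular_cubic a b c
  for K :: "'a::{field_char_0, alg_closed_field} set" and \<sigma> :: "'a \<Rightarrow> 'a" and a b c :: 'a +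
  assumes subfield_K: "is_subfield K" and coeffs: "a \<in> K" "b \<in> K" "c \<in> K"
begin

lemma exists_fixed_ordinate: "\<exists>y. \<sigma> y = y \<and> y\<^sup>2 = f (1 + a\<^sup>2 + b\<^sup>2 + c\<^sup>2 + 1 / of_nat m)"
proof -
  have "f (1 + a\<^sup>2 + b\<^sup>2 + c\<^sup>2 + 1 / of_nat m) \<in> nonneg"
    by (rule cubic_value_nonneg[OF _ _ _ inverse_of_nat_nonneg refl]) (simp_all add: coeffs hom)
  then show ?thesis
    by (auto simp: nonneg_def)
qed

lemma comm_group_points: "is_subfield F \<Longrightarrow> K \<subseteq> F \<Longrightarrow> comm_group (point_group F)"
  using comm_group_cubic_curve coeffs by blast

lemma exists_point_with_multiples_not_over:
  assumes F: "number_field F" "K \<subseteq> F"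
  shows "\<exists>x y. \<sigma> y = y \<and> y\<^sup>2 \<in> K \<and> quadratic_generator F y \<and>
    Affine x y \<in> points (quadratic_extension F y) \<and>
    (\<forall>k::int. k \<noteq> 0 \<longrightarrow> Affine x y [^]\<^bsub>point_group (quadratic_extension F y)\<^esub> k \<notin> points F)"
proof -
  define D where "D = 1 + a\<^sup>2 + b\<^sup>2 + c\<^sup>2"
  have D: "D \<in> K"
    using subfield_K coeffs by (simp add: D_def subfield_closed)
  have in_F: "a \<in> F" "b \<in> F" "c \<in> F" "D \<in> F"
    using coeffs D F(2) by auto
  obtain m :: nat where not_square: "\<forall>y\<in>F. y\<^sup>2 \<noteq> f (D + 1 / of_nat m)"
    and infinite_order: "\<forall>L y. is_subfield L \<and> a \<in> L \<and> b \<in> L \<and> c \<in> L \<and> Affine (D + 1 / of_nat m) y \<in> points L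
      \<longrightarrow> group.ord (point_group L) (Affine (D + 1 / of_nat m) y) = 0"
    using exists_generic_x[OF F(1) in_F] by blast
  define x where "x = D + 1 / of_nat m"
  obtain y where y: "\<sigma> y = y" "y\<^sup>2 = f x"
    using exists_fixed_ordinate unfolding x_def D_def by blast
  have x: "x \<in> K" and fx: "f x \<in> K"
    using subfield_K D coeffs by (simp_all add: x_def cubic_def subfield_closed)
  have generator: "quadratic_generator F y"
    using F not_square y(2) fx by (intro quadratic_generator.intro) (auto simp: number_field_def x_def)
  interpret quadratic_generator F y by fact
  interpret G: comm_group "point_group M"
    using F(2) extension_superset(1) by (intro comm_group_points is_subfield_extension) auto
  have P: "Affine x y \<in> points M"
    using x y(2) F(2) extension_superset by (auto simp: ec_points_def cubic_def)
  then have "G.ord (Affine x y) = 0"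
    using infinite_order is_subfield_extension in_F(1-3) extension_superset(1) by (auto simp: x_def)
  then have "Affine x y [^]\<^bsub>point_group M\<^esub> (2 * k) \<noteq> Infinity" if "k \<noteq> 0" for k :: int
    using G.int_pow_eq_id[of "Affine x y" "2 * k"] P that by simp
  then have "Affine x y [^]\<^bsub>point_group M\<^esub> k \<notin> points F" if "k \<noteq> 0" for k :: int
    using that x F(2) by (intro int_pow_not_over_base[OF generator in_F(1-3) _ y(2)]) auto
  then show ?thesis
    using y fx generator P by (intro exI[of _ x] exI[of _ y]) simp
qed

lemma exists_larger_field_with_point:
  assumes L: "is_subfield L" and roots: "\<And>y. \<sigma> y = y \<Longrightarrow> y\<^sup>2 \<in> K \<Longrightarrow> y \<in> L"
    and F: "number_field F" "K \<subseteq> F" "F \<subseteq> L"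
  shows "\<exists>F'. number_field F' \<and> F \<subseteq> F' \<and> F' \<subseteq> L \<and>
    (\<exists>P\<in>points F'. \<forall>k::int. k \<noteq> 0 \<longrightarrow> P [^]\<^bsub>point_group L\<^esub> k \<notin> points F)"
proof -
  obtain x y where y: "\<sigma> y = y" "y\<^sup>2 \<in> K" and "quadratic_generator F y"
    and P: "Affine x y \<in> points (quadratic_extension F y)"
    and multiples: "\<forall>k::int. k \<noteq> 0 \<longrightarrow> Affine x y [^]\<^bsub>point_group (quadratic_extension F y)\<^esub> k \<notin> points F"
    using exists_point_with_multiples_not_over[OF F(1,2)] by blast
  interpret quadratic_generator F y by fact
  have "M \<subseteq> L"
    using F(3) roots[OF y] by (auto simp: in_extension_iff intro!: subfield_closed[OF L])
  moreover have "K \<subseteq> M" "K \<subseteq> L"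
    using F(2,3) extension_superset(1) by auto
  ultimately have "Affine x y [^]\<^bsub>point_group L\<^esub> k = Affine x y [^]\<^bsub>point_group M\<^esub> k" for k :: int
    using comm_group_points[OF is_subfield_extension] comm_group_points[OF L] P
    by (intro int_pow_mordell_weil_group) (simp_all add: comm_group.axioms(2))
  then show ?thesis
    using multiples P \<open>M \<subseteq> L\<close> extension_superset(1) number_field_extension[OF F(1)]
    by (intro exI[of _ M] conjI bexI[of _ "Affine x y"]) simp_all
qed

lemma rank_infinite:
  assumes K: "number_field K" and L: "is_subfield L" "K \<subseteq> L"
    and roots: "\<And>y. \<sigma> y = y \<Longrightarrow> y\<^sup>2 \<in> K \<Longrightarrow> y \<in> L"
  shows "abelian_group_rank (point_group L) = \<infinity>"
proof -
  interpret G: comm_group "point_group L"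
    by (rule comm_group_points[OF L])
  define \<F> where "\<F> = {F. number_field F \<and> K \<subseteq> F \<and> F \<subseteq> L}"
  show ?thesis
  proof (rule G.rank_infinite)
    show "points ` \<F> \<noteq> {}"
      using K L(2) by (auto simp: \<F>_def)
    show "subgroup H (point_group L)" if "H \<in> points ` \<F>" for H
      using that subgroup_ec_points comm_group_points G.is_group
      by (auto simp: \<F>_def number_field_def comm_group_def)
    fix H assume "H \<in> points ` \<F>"
    then obtain F where F: "number_field F" "K \<subseteq> F" "F \<subseteq> L" "H = points F"
      by (auto simp: \<F>_def)
    obtain F' P where F': "number_field F'" "F \<subseteq> F'" "F' \<subseteq> L" "P \<in> points F'"
      and P: "\<forall>k::int. k \<noteq> 0 \<longrightarrow> P [^]\<^bsub>point_group L\<^esub> k \<notin> points F"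
      using exists_larger_field_with_point[OF L(1) roots F(1-3)] by blast
    have "F' \<in> \<F>" "points F \<subseteq> points F'"
      using F F' by (auto simp: \<F>_def ec_points_def)
    then show "\<exists>H'\<in>points ` \<F>. \<exists>P\<in>H'. H \<subseteq> H' \<and> (\<forall>k::int. k \<noteq> 0 \<longrightarrow> P [^]\<^bsub>point_group L\<^esub> k \<notin> H)"
      using F(4) F'(4) P by blast
  qed
qed

end

theorem theorem4p4:
  fixes K :: "'a::{field_char_0, alg_closed_field} set"
    and E :: "'a weierstrass"
    and \<sigma> :: "'a \<Rightarrow> 'a"
  assumes "number_field K"
    and "\<forall>x :: 'a. algebraic_over K x"
    and "elliptic_curve_over K E"
    and "complex_conjugation K \<sigma>"
  shows "abelian_group_rank (mordell_weil_group E (fixed_field (max_abelian_extension K) \<sigma>)) = \<infinity> \<and>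
         abelian_group_rank (mordell_weil_group E (fixed_field UNIV \<sigma>)) = \<infinity>"
proof -
  have K: "is_subfield K"
    using assms(1) by (simp add: number_field_def)
  interpret cubic_with_conjugation K \<sigma> "completed_a2 E" "completed_a4 E" "completed_a6 E"
    using assms(3,4) K completed_coeffs_in[OF K assms(3)] nonsingular_square_completed[of E]
    by (intro cubic_with_conjugation.intro complex_conjugation_automorphism.intro
        cubic_with_conjugation_axioms.intro) (simp_all add: elliptic_curve_over_def)
  note L = is_subfield_fixed_max_abelian and KL = subset_fixed_max_abelian[OF K]
  have E: "elliptic_curve_over fixed_max_abelian E"
    using assms(3) KL by (auto simp: elliptic_curve_over_def)
  have "abelian_group_rank (mordell_weil_group (square_completed E) fixed_max_abelian) = \<infinity>"
    by (rule rank_infinite[OF assms(1) L KL fixed_square_root_in_fixed_max_abelian[OF K]])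
  then have rank: "abelian_group_rank (mordell_weil_group E fixed_max_abelian) = \<infinity>"
    using rank_square_completed_le[OF L E] by simp
  have "abelian_group_rank (mordell_weil_group E fixed_max_abelian)
      \<le> abelian_group_rank (mordell_weil_group E (fixed_field UNIV \<sigma>))"
    by (intro rank_mono L E is_subfield_fixed_field is_subfield_UNIV) (auto simp: fixed_field_def)
  with rank show ?thesis
    by simp
qed

end
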